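(* Let $G$ be a finite cyclic group of order $|G|=p^\alpha q^\beta$, where $\alpha,\beta$ are positive integers and $p,q$ are distinct primes, such that $\gcd(|G|,6)=1$. Then every minimal zero-sum sequence $S$ over $G$ of length $|S|=4$ satisfies $\mathrm{ind}(S)=1$.
   Context: A sequence over $G$ is a finite unordered list of elements of $G$ with repetition allowed (an element of the free abelian monoid on $G$, written multiplicatively). $S$ is a zero-sum sequence if the sum of its terms is $0$, and a minimal zero-sum sequence if it is a zero-sum sequence and no proper nontrivial subsequence has sum zero. Let $n=|G|$. For a sequence $S$ over the cyclic group $G$ and a generator $g$ of $G$, write $S=(n_1g)\cdot\ldots\cdot(n_kg)$ with $1\le n_1,\dots,n_k\le n$ (uniquely determined), and set $\|S\|_g=(n_1+\cdots+n_k)/\mathrm{ord}(g)$. The index of $S$ is $\mathrm{ind}(S)=\min\{\|S\|_g : g\in G,\ \langle g\rangle=G\}$. *)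

theory Defs
  imports
    "HOL-Algebra.Elementary_Groups"
    "HOL-Algebra.Multiplicative_Group"
    "HOL-Computational_Algebra.Primes"
    "HOL-Library.Multiset"
begin

text \<open>
  The groups of HOL-Algebra are written multiplicatively: the sum of the terms of a sequence
  is the product in \<open>G\<close>, the neutral element \<open>0\<close> is \<open>\<one>\<^bsub>G\<^esub>\<close>, and the multiple \<open>n g\<close>
  is the power \<open>g [^]\<^bsub>G\<^esub> n\<close>.  A sequence over \<open>G\<close> is a multiset of elements of the carrier,
  so its length is \<open>size S\<close> and its subsequences are its sub-multisets.
\<close>

definition sequence_over :: "('a, 'b) monoid_scheme \<Rightarrow> 'a multiset \<Rightarrow> bool" where
  "sequence_over G S \<longleftrightarrow> set_mset S \<subseteq> carrier G"

definition seq_sum :: "('a, 'b) monoid_scheme \<Rightarrow> 'a multiset \<Rightarrow> 'a" where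
  "seq_sum G S = finprod G (\<lambda>x. x [^]\<^bsub>G\<^esub> count S x) (set_mset S)"

definition zero_sum :: "('a, 'b) monoid_scheme \<Rightarrow> 'a multiset \<Rightarrow> bool" where
  "zero_sum G S \<longleftrightarrow> sequence_over G S \<and> seq_sum G S = \<one>\<^bsub>G\<^esub>"

definition minimal_zero_sum :: "('a, 'b) monoid_scheme \<Rightarrow> 'a multiset \<Rightarrow> bool" where
  "minimal_zero_sum G S \<longleftrightarrow>
     zero_sum G S \<and> (\<forall>T. T \<subset># S \<and> T \<noteq> {#} \<longrightarrow> \<not> zero_sum G T)"

definition generators :: "('a, 'b) monoid_scheme \<Rightarrow> 'a set" where
  "generators G = {g \<in> carrier G. generate G {g} = carrier G}"

definition coefficient :: "('a, 'b) monoid_scheme \<Rightarrow> 'a \<Rightarrow> 'a \<Rightarrow> nat" where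
  "coefficient G g x = (THE m. 1 \<le> m \<and> m \<le> order G \<and> x = g [^]\<^bsub>G\<^esub> m)"

definition seq_norm :: "('a, 'b) monoid_scheme \<Rightarrow> 'a \<Rightarrow> 'a multiset \<Rightarrow> real" where
  "seq_norm G g S = real (\<Sum>x\<in>#S. coefficient G g x) / real (group.ord G g)"

definition seq_index :: "('a, 'b) monoid_scheme \<Rightarrow> 'a multiset \<Rightarrow> real" where
  "seq_index G S = Min ((\<lambda>g. seq_norm G g S) ` generators G)"

lemma (in comm_group) seq_sum_add_mset:
  assumes "x \<in> carrier G" "sequence_over G S"
  shows "seq_sum G (add_mset x S) = x \<otimes> seq_sum G S"
proof (cases "x \<in># S")
  case False
  then have c: "count S x = 0" by (simp add: not_in_iff)
  have "finprod G (\<lambda>y. y [^] count (add_mset x S) y) (set_mset S) = seq_sum G S"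
    unfolding seq_sum_def using assms False
    by (intro finprod_cong) (auto simp: sequence_over_def simp_implies_def)
  then show ?thesis
    using assms False c unfolding seq_sum_def
    by (subst set_mset_add_mset_insert, subst finprod_insert) (auto simp: sequence_over_def)
next
  case True
  let ?A = "set_mset S - {x}"
  have A: "set_mset S = insert x ?A" "finite ?A" "x \<notin> ?A" using True by auto
  have cl: "y \<in> carrier G" if "y \<in> ?A" for y using assms that by (auto simp: sequence_over_def)
  have 1: "seq_sum G T = x [^] count T x \<otimes> finprod G (\<lambda>y. y [^] count T y) ?A"
    if "set_mset T = set_mset S" for T
    unfolding seq_sum_def that
    by (subst A(1), subst finprod_insert) (use A cl assms in auto)
  have 2: "finprod G (\<lambda>y. y [^] count (add_mset x S) y) ?A = finprod G (\<lambda>y. y [^] count S y) ?A"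
    using cl by (intro finprod_cong) (auto simp: simp_implies_def)
  have 3: "x [^] count (add_mset x S) x = x \<otimes> x [^] count S x"
    using assms(1) by (simp add: m_comm)
  have 4: "finprod G (\<lambda>y. y [^] count S y) ?A \<in> carrier G"
    using cl by (intro finprod_closed) auto
  have "set_mset (add_mset x S) = set_mset S" using True by auto
  then show ?thesis
    using 1[of S] 1[of "add_mset x S"] 2 3 4 assms(1) by (simp add: m_assoc)
qed

lemma (in group) ex1_coefficient:
  assumes "finite (carrier G)" "g \<in> generators G" "x \<in> carrier G"
  shows "\<exists>!m. 1 \<le> m \<and> m \<le> order G \<and> x = g [^] m"
proof -
  have g: "g \<in> carrier G" and gen: "generate G {g} = carrier G"
    using assms by (auto simp: generators_def)
  have o: "ord g = order G"
    using generate_pow_card[OF g] gen by (simp add: order_def)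
  have pos: "ord g \<ge> 1" using ord_ge_1[OF assms(1) g] .
  have "x \<in> {g [^] k | k. k \<in> {0 .. ord g - 1}}"
    using generate_pow_on_finite_carrier[OF assms(1) g] ord_elems[OF assms(1) g] gen assms(3)
    by simp
  then obtain k where k: "k \<le> ord g - 1" "x = g [^] k" by auto
  have "\<exists>m. m \<in> {1..ord g} \<and> x = g [^] m"
  proof (cases "k = 0")
    case True
    then have "x = g [^] ord g" using k g by (simp add: pow_ord_eq_1)
    then show ?thesis using pos by force
  next
    case False
    then show ?thesis using k pos by (intro exI[of _ k]) auto
  qed
  then obtain m where "m \<in> {1..ord g}" "x = g [^] m" by blast
  then show ?thesis
    using ord_inj'[OF g] unfolding inj_on_def o by (metis atLeastAtMost_iff)
qed

lemma (in group) generators_finite_nonempty: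
  assumes "finite (carrier G)" "cyclic_group G"
  shows "finite (generators G)" "generators G \<noteq> {}"
proof -
  show "finite (generators G)" using assms(1) by (simp add: generators_def)
  obtain x where x: "x \<in> carrier G" "subgroup_generated G {x} = G"
    using assms(2) unfolding cyclic_group_def by blast
  then have "generate G {x} = carrier G"
    by (metis carrier_subgroup_generated Int_insert_right_if1 Int_empty_right)
  then show "generators G \<noteq> {}" using x(1) by (auto simp: generators_def)
qed

end

theory Submission
  imports Defs "HOL-Number_Theory.Cong"
begin

text \<open>
  Write the terms as multiples \<open>a, b, c, d\<close> of a generator. For a unit \<open>m\<close> modulo \<open>n\<close> the least
  residues of \<open>m * a, m * b, m * c, m * d\<close> add up to \<open>n\<close>, \<open>2 * n\<close> or \<open>3 * n\<close>, and \<open>- m\<close> exchanges the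
  first and the last value. So if the index is not 1, the sum is \<open>2 * n\<close> for every unit (the
  quadruple is balanced), and it has to be shown that two of the four numbers then cancel modulo \<open>n\<close>.

  We may assume that no prime divisor of \<open>n\<close> divides all four numbers. Summing the balance equation
  over a class of units modulo \<open>n / p\<close> settles the case that some of the numbers are divisible by a
  prime divisor \<open>p\<close> of \<open>n\<close>. If all four are units and \<open>p\<^sup>2\<close> divides \<open>n\<close>, the quadruple is also
  balanced modulo \<open>n / p\<close>, and a cancelling pair modulo \<open>n / p\<close> lifts to one modulo \<open>n\<close> by comparing
  leading digits. This leaves \<open>n\<close> prime or \<open>n = p * q\<close> with \<open>p < q\<close>. Expanding
  \<open>(m * a mod n) ^ (k + 1)\<close> modulo \<open>q\<^sup>2\<close> and summing over the units \<open>m\<close> in a fixed class modulo \<open>p\<close>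
  gives, for \<open>k = 1, 2, 3\<close>, linear relations modulo \<open>q\<close> between the values of the Bernoulli polynomial
  \<open>B\<^bsub>k+1\<^esub>\<close> at the residues of the four numbers modulo \<open>p\<close>, with the \<open>k\<close>-th powers of their inverses as
  coefficients. Since \<open>p < q\<close>, these relations determine the residues modulo \<open>p\<close> well enough.
\<close>

section \<open>Units modulo an integer coprime to 6\<close>

definition balanced :: "int \<Rightarrow> int \<Rightarrow> int \<Rightarrow> int \<Rightarrow> int \<Rightarrow> bool" where
  "balanced n a b c d \<longleftrightarrow>
     (\<forall>m. coprime m n \<longrightarrow> m * a mod n + m * b mod n + m * c mod n + m * d mod n = 2 * n)"

lemma balancedD:
  "balanced n a b c d \<Longrightarrow> coprime m n \<Longrightarrow>
     m * a mod n + m * b mod n + m * c mod n + m * d mod n = 2 * n"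
  by (simp add: balanced_def)

lemma coprime_6_not_dvd:
  fixes n :: int
  assumes "coprime n 6"
  shows "\<not> 2 dvd n" "\<not> 3 dvd n"
proof -
  have "\<not> is_unit (2::int)" "\<not> is_unit (3::int)" "2 dvd (6::int)" "3 dvd (6::int)" by simp_all
  thus "\<not> 2 dvd n" "\<not> 3 dvd n"
    using assms coprime_common_divisor by blast+
qed

lemma coprime_6_ge_5:
  fixes k n :: int
  assumes "coprime n 6" "k dvd n" "k > 1"
  shows "k \<ge> 5"
proof -
  have "\<not> 2 dvd k" "\<not> 3 dvd k" using coprime_6_not_dvd[OF assms(1)] assms(2) dvd_trans by blast+
  hence "k \<noteq> 2" "k \<noteq> 3" "k \<noteq> 4" by auto
  thus ?thesis using assms(3) by linarith
qed

lemma coprime_int_prime_iff: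
  fixes a b :: int
  assumes "b \<noteq> 0"
  shows "coprime a b \<longleftrightarrow> (\<forall>r. prime r \<longrightarrow> r dvd b \<longrightarrow> \<not> r dvd a)"
proof
  assume "coprime a b"
  thus "\<forall>r. prime r \<longrightarrow> r dvd b \<longrightarrow> \<not> r dvd a"
    using coprime_common_divisor not_prime_unit by blast
next
  assume *: "\<forall>r. prime r \<longrightarrow> r dvd b \<longrightarrow> \<not> r dvd a"
  show "coprime a b"
  proof (rule ccontr)
    assume "\<not> coprime a b"
    hence "\<not> is_unit (gcd a b)" by (simp add: coprime_iff_gcd_eq_1)
    moreover have "gcd a b \<noteq> 0" using assms by simp
    ultimately obtain r where "prime r" "r dvd gcd a b"
      using prime_divisor_exists by blast
    thus False using * by auto
  qed
qed

text \<open>The lift is \<open>x + D * k\<close>, with \<open>D\<close> the product of the primes of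
  \<open>n\<close> that do not divide \<open>x\<close>: every prime of \<open>n\<close> divides
  exactly one of the two summands, hence not their sum.\<close>

lemma coprime_lift:
  fixes x k n :: int
  assumes "coprime x k" "k dvd n" "n \<noteq> 0"
  obtains m where "coprime m n" "[m = x] (mod k)"
proof -
  define D where "D = \<Prod>{r \<in> prime_factors n. \<not> r dvd x}"
  have fin: "finite {r \<in> prime_factors n. \<not> r dvd x}" by simp
  have "coprime (x + D * k) n"
    unfolding coprime_int_prime_iff[OF assms(3)]
  proof (intro allI impI notI)
    fix r :: int
    assume r: "prime r" "r dvd n" "r dvd x + D * k"
    show False
    proof (cases "r dvd x")
      case False
      have "r dvd D"
        unfolding D_def using fin by (rule dvd_prodI) (use r False assms(3) in \<open>auto simp: prime_factors_dvd\<close>)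
      thus False using r(3) False by (simp add: dvd_add_left_iff)
    next
      case True
      hence "r dvd D * k" using r(3) by (simp add: dvd_add_right_iff)
      moreover have "\<not> r dvd k" using True r(1) assms(1) coprime_common_divisor not_prime_unit by blast
      ultimately have "r dvd D" using r(1) by (simp add: prime_dvd_mult_iff)
      then obtain s where "s \<in> prime_factors n" "\<not> s dvd x" "r dvd s"
        unfolding D_def using r(1) fin by (auto simp: prime_dvd_prod_iff)
      thus False using True r(1) by (metis in_prime_factors_imp_prime primes_dvd_imp_eq)
    qed
  qed
  thus ?thesis by (rule that) (simp add: cong_def)
qed

text \<open>Division by \<open>g = gcd y n\<close> makes \<open>y div g\<close> invertible modulo
  \<open>n div g\<close>, and the inverse lifts to a unit modulo \<open>n\<close>. As
  \<open>n\<close> does not divide \<open>y\<close>, \<open>g < n\<close> is its own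
  residue.\<close>

lemma ex_unit_mult_eq_gcd:
  fixes y n :: int
  assumes "n > 0" "\<not> n dvd y"
  obtains m where "coprime m n" "m * y mod n = gcd y n"
proof -
  define g where "g = gcd y n"
  have g: "g > 0" "g dvd y" "g dvd n" using assms(1) by (auto simp: g_def)
  have "g \<noteq> n" using assms(2) g(2) by blast
  moreover have "g \<le> n" using g(3) assms(1) by (rule zdvd_imp_le)
  ultimately have gn: "g < n" by simp
  define y' where "y' = y div g"
  define n' where "n' = n div g"
  have e: "y = y' * g" "n = n' * g" using g by (simp_all add: y'_def n'_def)
  have e3: "coprime y' n'" using assms(1) by (simp add: y'_def n'_def g_def div_gcd_coprime)
  obtain x where x: "[y' * x = 1] (mod n')" using cong_solve_coprime_int e3 by blast
  have "coprime x n'" using x e3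
    by (metis cong_imp_coprime cong_sym coprime_1_left coprime_mult_left_iff)
  moreover have "n' dvd n" "n \<noteq> 0" using e(2) assms(1) by auto
  ultimately obtain m where m: "coprime m n" "[m = x] (mod n')" by (rule coprime_lift)
  have "[m * y' = 1] (mod n')" using m x by (metis cong_scalar_right cong_trans mult.commute)
  hence "[m * y' * g = 1 * g] (mod (n' * g))" by (metis cong_cmult_rightI mult.commute)
  hence "m * y mod n = g mod n" by (simp add: cong_def e mult.assoc)
  also have "\<dots> = g" using g gn by simp
  finally show ?thesis using that m(1) by (simp add: g_def)
qed

text \<open>If \<open>y\<close> is nonzero modulo \<open>n\<close>, some unit multiple of it is
  \<open>g = gcd y n\<close>, and \<open>5 * g \<le> n\<close> because \<open>n\<close> is coprime
  to 6. The unit \<open>h = (n - 1) div 2\<close> turns \<open>g\<close> into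
  \<open>(n - g) div 2\<close>, which is at least 2n/5 and below n/2, in the forbidden middle
  fifth.\<close>

lemma dvd_if_unit_multiples_near_0:
  fixes y n :: int
  assumes n: "n > 0" "coprime n 6"
    and near: "\<And>m. coprime m n \<Longrightarrow> 5 * (m * y mod n) < 2 * n \<or> 3 * n \<le> 5 * (m * y mod n)"
  shows "n dvd y"
proof (rule ccontr)
  assume "\<not> n dvd y"
  then obtain m where m: "coprime m n" "m * y mod n = gcd y n"
    using ex_unit_mult_eq_gcd n(1) by blast
  define g where "g = gcd y n"
  have g: "g > 0" "g dvd n" using n(1) by (auto simp: g_def)
  have "g \<noteq> n" using \<open>\<not> n dvd y\<close> by (metis g_def gcd_dvd1)
  then obtain k where k: "n = g * k" "k > 1"
    using g n(1) by (metis dvdE int_one_le_iff_zero_less mult.right_neutral order_le_less zero_less_mult_pos)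
  have "k \<ge> 5" using coprime_6_ge_5[OF n(2)] k by simp
  hence g5: "5 * g \<le> n" using k g(1) by simp
  have "odd n" using coprime_6_not_dvd[OF n(2)] by simp
  then obtain h where h: "n = 2 * h + 1" by (auto elim: oddE)
  have "coprime h n" by (rule coprimeI) (use h in \<open>metis dvd_add_right_iff dvd_mult\<close>)
  hence u: "coprime (m * h) n" using m(1) by simp
  have "odd g" "odd k" using \<open>odd n\<close> k by auto
  \<comment> \<open>This is half of \<open>2 * h * g = (n - 1) * g = n * (g - 1) + (n - g)\<close>,
    where \<open>g - 1\<close> and \<open>n - g\<close> are even.\<close>
  have "h * g = n * ((g - 1) div 2) + (n - g) div 2"
  proof -
    obtain g' k' where "g = 2 * g' + 1" "k = 2 * k' + 1" using \<open>odd g\<close> \<open>odd k\<close> by (auto elim!: oddE)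
    hence "n = 2 * (2 * g' * k' + g' + k') + 1" "g = 2 * g' + 1" using k by (auto simp: algebra_simps)
    moreover from this have "h = 2 * g' * k' + g' + k'" using h by simp
    ultimately show ?thesis by (simp add: algebra_simps)
  qed
  moreover have "0 \<le> (n - g) div 2" "(n - g) div 2 < n" using g5 g n by auto
  ultimately have "h * g mod n = (n - g) div 2" by simp
  moreover have "m * h * y mod n = h * g mod n"
    using m(2) by (metis g_def mod_mult_right_eq mult.assoc mult.commute)
  ultimately have "5 * ((n - g) div 2) < 2 * n \<or> 3 * n \<le> 5 * ((n - g) div 2)"
    using near[OF u] by simp
  moreover have "2 * ((n - g) div 2) = n - g" using \<open>odd n\<close> \<open>odd g\<close> by simp
  ultimately show False using g5 g(1) by linarith
qed

section \<open>Quadruples with terms divisible by a prime divisor of the modulus\<close>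

text \<open>A residue modulo \<open>p * k\<close> has a low digit modulo \<open>k\<close> and a high
  digit modulo \<open>p\<close>. Passing to \<open>m + j * k\<close> adds \<open>k * (j * a)\<close>
  to the product, which keeps the low digit and translates the high one by
  \<open>j * a\<close>.\<close>

lemma mod_shift_digit:
  fixes m j k p a :: int
  assumes "p > 0" "k > 0"
  shows "(m + j * k) * a mod (p * k) = m * a mod k + k * ((m * a div k + j * a) mod p)"
proof -
  have "(m + j * k) * a mod (k * p) = k * (((m + j * k) * a) div k mod p) + ((m + j * k) * a) mod k"
    using assms by (intro zmod_zmult2_eq) simp
  moreover have e: "(m + j * k) * a = m * a + k * (j * a)" by (simp add: algebra_simps)
  have "((m + j * k) * a) div k = m * a div k + j * a" "((m + j * k) * a) mod k = m * a mod k"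
    unfolding e using assms by simp_all
  ultimately show ?thesis by (simp add: mult.commute)
qed

lemma bij_betw_affine_mod:
  fixes p a t :: int
  assumes "p > 0" "coprime a p"
  shows "bij_betw (\<lambda>j. (t + j * a) mod p) {0..<p} {0..<p}"
proof -
  have inj: "inj_on (\<lambda>j. (t + j * a) mod p) {0..<p}"
  proof (rule inj_onI)
    fix i j assume ij: "i \<in> {0..<p}" "j \<in> {0..<p}" "(t + i * a) mod p = (t + j * a) mod p"
    hence "[t + i * a = t + j * a] (mod p)" by (simp add: cong_def)
    hence "[i * a = j * a] (mod p)" by (simp add: cong_add_lcancel)
    hence "[i = j] (mod p)" using assms(2) by (simp add: cong_mult_rcancel)
    thus "i = j" using ij by (simp add: cong_def)
  qed
  moreover have "(\<lambda>j. (t + j * a) mod p) ` {0..<p} \<subseteq> {0..<p}" using assms(1) by auto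
  ultimately show ?thesis unfolding bij_betw_def using endo_inj_surj by blast
qed

lemma sum_atLeastLessThan_int:
  fixes p :: int
  assumes "p \<ge> 0"
  shows "2 * (\<Sum>j\<in>{0..<p}. j) = p * (p - 1)"
  using assms
proof (induction p rule: int_ge_induct)
  case (step p)
  have "{0..<p + 1} = insert p {0..<p}" using step by auto
  thus ?case using step by (simp add: algebra_simps)
qed simp

text \<open>For \<open>a\<close> prime to \<open>p\<close> the high digit takes each value from 0 to
  \<open>p - 1\<close> once, so the sum depends only on the low digit of \<open>m * a\<close>. The
  factor 2 clears the denominator of the sum of the digits.\<close>

lemma sum_mod_shift:
  fixes m k p a :: int
  assumes "p > 0" "k > 0" "coprime a p"
  shows "2 * (\<Sum>j\<in>{0..<p}. (m + j * k) * a mod (p * k)) = 2 * p * (m * a mod k) + k * p * (p - 1)"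
proof -
  have "(\<Sum>j\<in>{0..<p}. (m * a div k + j * a) mod p) = (\<Sum>j\<in>{0..<p}. j)"
    using bij_betw_affine_mod[OF assms(1,3)] by (rule sum.reindex_bij_betw)
  hence e: "(\<Sum>j\<in>{0..<p}. (m + j * k) * a mod (p * k)) = p * (m * a mod k) + k * (\<Sum>j\<in>{0..<p}. j)"
    using assms by (simp add: mod_shift_digit sum.distrib flip: sum_distrib_left)
  have "2 * (\<Sum>j\<in>{0..<p}. (m + j * k) * a mod (p * k))
      = 2 * p * (m * a mod k) + k * (2 * (\<Sum>j\<in>{0..<p}. j))"
    unfolding e by (simp only: distrib_left mult.assoc mult.left_commute)
  also have "\<dots> = 2 * p * (m * a mod k) + k * (p * (p - 1))"
    using sum_atLeastLessThan_int[of p] assms(1) by simp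
  finally show ?thesis by (simp only: mult.assoc)
qed

lemma ex_mod_shift_digit:
  fixes m k p a t :: int
  assumes "p > 0" "k > 0" "coprime a p" "0 \<le> t" "t < p"
  obtains j where "0 \<le> j" "j < p" "(m + j * k) * a mod (p * k) = m * a mod k + k * t"
proof -
  have "t \<in> (\<lambda>j. (m * a div k + j * a) mod p) ` {0..<p}"
    using bij_betw_affine_mod[OF assms(1,3), of "m * a div k"] assms(4,5) by (simp add: bij_betw_def)
  thus ?thesis using that mod_shift_digit[OF assms(1,2)] by force
qed

lemma mod_shift_dvd:
  fixes m j k p a :: int
  assumes "p dvd a"
  shows "(m + j * k) * a mod (p * k) = m * a mod (p * k)"
proof -
  obtain a' where "a = p * a'" using assms by blast
  hence "(m + j * k) * a = m * a + (p * k) * (j * a')" by (simp add: algebra_simps)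
  thus ?thesis by (simp only: mod_mult_self2)
qed

lemma coprime_shift:
  fixes m j k p :: int
  assumes "prime p" "coprime m k" "\<not> p dvd m + j * k"
  shows "coprime (m + j * k) (p * k)"
proof -
  have "coprime (m + j * k) k" using assms(2)
    by (metis coprime_iff_gcd_eq_1 gcd_add_mult gcd.commute add.commute)
  moreover have "coprime (m + j * k) p" using assms(1,3) prime_imp_coprime coprime_commute by blast
  ultimately show ?thesis by simp
qed

text \<open>When \<open>p\<close> divides \<open>k\<close>, coprimality to \<open>k\<close> includes
  coprimality to \<open>p\<close>. The whole class of \<open>m\<close> modulo \<open>k\<close> then
  consists of units, so balance equations can be averaged over all of it.\<close>

lemma coprime_shift_sq:
  fixes m j k p :: int
  assumes "prime p" "p dvd k" "coprime m k"
  shows "coprime (m + j * k) (p * k)"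
proof (rule coprime_shift[OF assms(1,3)])
  have "coprime m p" using assms(2,3) by (meson coprime_divisors dvd_refl)
  hence "\<not> p dvd m" using assms(1) coprime_common_divisor dvd_refl not_prime_unit by blast
  thus "\<not> p dvd m + j * k" using assms(2) by (simp add: dvd_add_left_iff)
qed

text \<open>
  Along the class of \<open>m\<close> modulo \<open>n / p\<close> only the residues of \<open>m * a\<close> and \<open>m * b\<close> move, with constant
  sum, while the residue of \<open>m * a\<close> takes nearly its smallest and nearly its largest value. This
  forces \<open>m * (a + b)\<close> to be close to \<open>0\<close> modulo \<open>n\<close>.
\<close>

lemma balanced_two_nondivisible:
  fixes n p a b c d :: int
  assumes n: "n > 0" "coprime n 6" and p: "prime p" "p dvd n"
    and nd: "\<not> p dvd a" "\<not> p dvd b" and d: "p dvd c" "p dvd d"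
    and sum: "n dvd a + b + c + d" and bal: "balanced n a b c d"
  shows "n dvd a + b"
proof (rule dvd_if_unit_multiples_near_0[OF n])
  fix m assume m: "coprime m n"
  obtain k where k: "n = p * k" using p(2) by blast
  have p5: "p \<ge> 5" using coprime_6_ge_5[OF n(2) p(2)] p(1) by (simp add: prime_gt_1_int)
  hence p0: "p > 0" by simp
  have k0: "k > 0" using n(1) k p0 by (simp add: zero_less_mult_iff)
  have mk: "coprime m k" and mp: "coprime m p" using m k by auto
  have ca: "coprime a p" "coprime b p" using nd p(1) prime_imp_coprime coprime_commute by blast+
  have pab: "p dvd a + b"
    using sum d p(2) by (metis dvd_add_left_iff dvd_trans)
  \<comment> \<open>\<open>Y\<close> is the residue to be located; \<open>C\<close> will be the
    constant sum of the two moving residues and is congruent to \<open>Y\<close> modulo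
    \<open>n\<close>.\<close>
  define Y where "Y = m * (a + b) mod n"
  define C where "C = 2 * n - m * c mod n - m * d mod n"
  have good: "(m + j * k) * a mod n + (m + j * k) * b mod n = C
      \<and> ((m + j * k) * a mod n + (m + j * k) * b mod n) mod n = Y"
    if "\<not> p dvd m + j * k" for j
  proof -
    have "coprime (m + j * k) n" unfolding k using coprime_shift[OF p(1) mk that] .
    from balancedD[OF bal this] 
    have "(m + j * k) * a mod n + (m + j * k) * b mod n = C"
      unfolding C_def k using mod_shift_dvd[OF d(1)] mod_shift_dvd[OF d(2)] by simp
    moreover have "((m + j * k) * a mod n + (m + j * k) * b mod n) mod n = (m + j * k) * (a + b) mod n"
      by (simp add: mod_add_eq algebra_simps)
    moreover have "(m + j * k) * (a + b) mod n = Y"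
      unfolding Y_def k using mod_shift_dvd[OF pab] .
    ultimately show ?thesis by simp
  qed
  \<comment> \<open>At most one shift \<open>j\<close> gives a non-unit, so of any two high digits
    at least one occurs at a unit. Below, the pairs 0, 1 and \<open>p - 2\<close>,
    \<open>p - 1\<close> supply a small and a large residue.\<close>
  have ex: "\<exists>j. \<not> p dvd m + j * k \<and> (\<exists>u\<in>{s, t}. (m + j * k) * a mod n = m * a mod k + k * u)"
    if st: "0 \<le> s" "s < t" "t < p" for s t
  proof -
    have "0 \<le> s" "s < p" using st by simp_all
    then obtain i where i: "0 \<le> i" "i < p" "(m + i * k) * a mod n = m * a mod k + k * s"
      unfolding k by (rule ex_mod_shift_digit[OF p0 k0 ca(1)])
    have "0 \<le> t" "t < p" using st by simp_all
    then obtain j where j: "0 \<le> j" "j < p" "(m + j * k) * a mod n = m * a mod k + k * t"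
      unfolding k by (rule ex_mod_shift_digit[OF p0 k0 ca(1)])
    have ij: "i \<noteq> j" using i j st k0 by auto
    have "\<not> (p dvd m + i * k \<and> p dvd m + j * k)"
    proof
      assume *: "p dvd m + i * k \<and> p dvd m + j * k"
      hence "p dvd (i - j) * k"
        by (metis add_diff_cancel_left dvd_diff left_diff_distrib)
      moreover have "\<not> p dvd i - j" using ij i j
        by (metis atLeastLessThan_iff cong_def cong_iff_dvd_diff mod_pos_pos_trivial)
      ultimately have "p dvd k" using p(1) by (simp add: prime_dvd_mult_iff)
      hence "p dvd m" using * by (simp add: dvd_add_left_iff)
      thus False using mp p(1) coprime_common_divisor dvd_refl not_prime_unit by blast
    qed
    thus ?thesis using i j by blast
  qed
  have e0: "0 \<le> m * a mod k" "m * a mod k < k" using k0 by simp_all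
  have "\<exists>i. \<not> p dvd m + i * k \<and> (\<exists>u\<in>{0, 1}. (m + i * k) * a mod n = m * a mod k + k * u)"
    by (rule ex) (use p5 in auto)
  then obtain i u where i: "\<not> p dvd m + i * k" "(m + i * k) * a mod n = m * a mod k + k * u"
      and "u \<in> {0, 1}"
    by blast
  hence u1: "u \<le> 1" by auto
  obtain j v where j: "\<not> p dvd m + j * k" "(m + j * k) * a mod n = m * a mod k + k * v" "v \<ge> p - 2"
    using ex[of "p - 2" "p - 1"] p5 by force
  have r: "0 \<le> x mod n" "x mod n < n" for x using n(1) by simp_all
  have CY: "C mod n = Y" using good[OF i(1)] by metis
  have C0: "0 \<le> C" "C < 2 * n" using good[OF i(1)] r[of "(m + i * k) * a"] r[of "(m + i * k) * b"] by linarith+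
  have "C = Y \<or> C = Y + n"
  proof (cases "C < n")
    case False
    have "C mod n = (C - n) mod n" by simp
    also have "\<dots> = C - n" using False C0 by (intro mod_pos_pos_trivial) auto
    finally show ?thesis using CY by simp
  qed (use CY C0 in simp)
  \<comment> \<open>If \<open>C = Y\<close>, the large residue of \<open>a\<close> gives
    \<open>Y \<ge> k * (p - 2)\<close>, at least 3n/5. If \<open>C = Y + n\<close>, every residue of
    \<open>a\<close> exceeds \<open>Y\<close> because that of \<open>b\<close> is below
    \<open>n\<close>; the small one gives \<open>Y < 2 * k\<close>, at most 2n/5.\<close>
  thus "5 * Y < 2 * n \<or> 3 * n \<le> 5 * Y"
  proof
    assume "C = Y"
    hence "Y \<ge> m * a mod k + k * v" using good[OF j(1)] j(2) r[of "(m + j * k) * b"] by linarith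
    moreover have "k * v \<ge> k * (p - 2)" using j(3) k0 by simp
    ultimately have "Y \<ge> k * (p - 2)" using e0 by linarith
    hence "5 * Y \<ge> 5 * (k * (p - 2))" by simp
    moreover have "5 * (k * (p - 2)) = 3 * n + 2 * (k * (p - 5))" unfolding k by (simp add: algebra_simps)
    moreover have "k * (p - 5) \<ge> 0" using p5 k0 by simp
    ultimately show ?thesis by linarith
  next
    assume "C = Y + n"
    hence "Y < m * a mod k + k * u" using good[OF i(1)] i(2) r[of "(m + i * k) * b"] by linarith
    moreover have "k * u \<le> k * 1" using u1 k0 by (intro mult_left_mono) auto
    ultimately have "Y < 2 * k" using e0 by linarith
    moreover have "k * 5 \<le> k * p" using p5 k0 by simp
    hence "5 * k \<le> n" using k by (simp add: mult.commute)
    ultimately show ?thesis by linarith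
  qed
qed

text \<open>Take \<open>m\<close> with \<open>m * d mod n = gcd d n\<close>, at most n/5, and
  average the balance equation over the class of \<open>m\<close> modulo \<open>k\<close>. The
  average residues of \<open>a\<close>, \<open>b\<close>, \<open>c\<close> are each below (n + k)/2,
  hence below 3n/5, while that of \<open>d\<close> stays at most n/5. The total is below 2n.\<close>

lemma not_balanced_three_nondivisible_sq:
  fixes n p k a b c d :: int
  assumes n: "n > 0" "coprime n 6" and p: "prime p" "n = p * k" "p dvd k"
    and nd: "\<not> p dvd a" "\<not> p dvd b" "\<not> p dvd c" and d: "p dvd d" "\<not> n dvd d"
  shows "\<not> balanced n a b c d"
proof
  assume bal: "balanced n a b c d"
  have p5: "p \<ge> 5" using coprime_6_ge_5[OF n(2)] p(1,2) by (simp add: prime_gt_1_int)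
  hence p0: "p > 0" by simp
  have k0: "k > 0" using n(1) p(2) p0 by (simp add: zero_less_mult_iff)
  obtain m where m: "coprime m n" "m * d mod n = gcd d n"
    using ex_unit_mult_eq_gcd[OF n(1) d(2)] by blast
  define g where "g = gcd d n"
  have g: "g > 0" "g dvd n" using n(1) by (auto simp: g_def)
  have "g \<noteq> n" using d(2) by (metis g_def gcd_dvd1)
  then obtain h where h: "n = g * h" "h > 1"
    using g n(1) by (metis dvdE int_one_le_iff_zero_less mult.right_neutral order_le_less zero_less_mult_pos)
  have "h \<ge> 5" using coprime_6_ge_5[OF n(2)] h by simp
  hence g5: "5 * g \<le> n" using h g(1) by simp
  have co: "coprime a p" "coprime b p" "coprime c p"
    using nd p(1) prime_imp_coprime coprime_commute by blast+
  have cop: "coprime (m + j * k) n" for j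
    unfolding p(2) by (rule coprime_shift_sq[OF p(1,3)]) (use m(1) p(2) in simp)
  let ?S = "\<lambda>x. \<Sum>j\<in>{0..<p}. (m + j * k) * x mod n"
  have "?S a + ?S b + ?S c + ?S d
      = (\<Sum>j\<in>{0..<p}. (m + j * k) * a mod n + (m + j * k) * b mod n + (m + j * k) * c mod n + (m + j * k) * d mod n)"
    by (simp add: sum.distrib)
  also have "\<dots> = (\<Sum>j\<in>{0..<p}. 2 * n)"
    by (intro sum.cong refl balancedD[OF bal] cop)
  also have "\<dots> = 2 * n * p" using p0 by simp
  finally have tot: "?S a + ?S b + ?S c + ?S d = 2 * n * p" .
  have "m * d mod (p * k) = g" using m(2) unfolding g_def p(2) .
  hence Sd: "?S d = p * g"
    unfolding p(2) using p0 by (simp add: mod_shift_dvd[OF d(1)])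
  have Sx: "2 * ?S x = 2 * p * (m * x mod k) + k * p * (p - 1)" if "coprime x p" for x
    unfolding p(2) by (rule sum_mod_shift[OF p0 k0 that])
  have "(2 * p * (m * a mod k) + k * p * (p - 1)) + (2 * p * (m * b mod k) + k * p * (p - 1))
     + (2 * p * (m * c mod k) + k * p * (p - 1)) + 2 * (p * g) = 2 * (2 * n * p)"
    using Sx[OF co(1)] Sx[OF co(2)] Sx[OF co(3)] Sd tot by linarith
  hence "p * (2 * (m * a mod k + m * b mod k + m * c mod k) + 3 * (k * (p - 1)) + 2 * g) = p * (4 * n)"
    by (simp add: algebra_simps)
  hence eq: "2 * (m * a mod k + m * b mod k + m * c mod k) + 3 * (k * (p - 1)) + 2 * g = 4 * n"
    using p0 by simp
  have lt: "m * a mod k < k" "m * b mod k < k" "m * c mod k < k" using k0 by simp_all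
  have "k * (p - 1) = n - k" using p(2) by (simp add: algebra_simps)
  with eq have "2 * (m * a mod k + m * b mod k + m * c mod k) + 3 * (n - k) + 2 * g = 4 * n"
    by (simp only:)
  moreover have "k * 5 \<le> k * p" using p5 k0 by simp
  hence "5 * k \<le> n" using p(2) by (simp add: mult.commute)
  moreover have False
    if "2 * (x + y + z) + 3 * (n - k) + 2 * g = 4 * n" "5 * k \<le> n" "x < k" "y < k" "z < k" for x y z
    using that g5 by presburger
  ultimately show False using lt by blast
qed

text \<open>
  For \<open>p \<ge> 7\<close> the choice \<open>\<mu> * d \<equiv> 1\<close> violates the relation by size alone. For \<open>p = 5\<close> it leaves only
  \<open>5 * \<mu> * (a, b, c) \<equiv> - (1, 1, 3)\<close> or \<open>- (1, 2, 2)\<close> up to order, refuted by the relation at \<open>- 5 * \<mu>\<close>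
  when \<open>k \<ge> 11\<close> and at \<open>3 * \<mu>\<close> when \<open>k = 7\<close>.
\<close>

lemma not_balanced_three_nondivisible_aux:
  fixes k p a b c d :: int
  assumes p: "p = 5 \<or> p \<ge> 7" and k: "coprime k 6" "coprime k p" "k > 1"
    and d: "coprime d k" and sum: "k dvd a + b + c + d"
    and eq: "\<And>\<mu>. coprime \<mu> k \<Longrightarrow>
      2 * ((p * \<mu> * a mod k - \<mu> * a mod k) + (p * \<mu> * b mod k - \<mu> * b mod k)
         + (p * \<mu> * c mod k - \<mu> * c mod k)) + 2 * (p - 1) * (\<mu> * d mod k) = (p - 1) * k"
  shows False
proof -
  have k5: "k \<ge> 5" using coprime_6_ge_5[OF k(1)] k(3) by simp
  obtain \<mu> where m: "[d * \<mu> = 1] (mod k)" using cong_solve_coprime_int d by blast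
  have co: "coprime \<mu> k" using m d
    by (metis cong_imp_coprime cong_sym coprime_1_left coprime_mult_left_iff)
  have md: "\<mu> * d mod k = 1" using m k(3) by (simp add: cong_def mult.commute)
  define x where "x = \<mu> * a mod k"
  define y where "y = \<mu> * b mod k"
  define z where "z = \<mu> * c mod k"
  have xyz: "0 \<le> x" "x < k" "0 \<le> y" "y < k" "0 \<le> z" "z < k"
    using k(3) by (simp_all add: x_def y_def z_def)
  have m_eq: "t * \<mu> * a mod k = t * x mod k" "t * \<mu> * b mod k = t * y mod k"
    "t * \<mu> * c mod k = t * z mod k" "t * \<mu> * d mod k = t mod k" for t
    using md unfolding x_def y_def z_def by (metis mod_mult_right_eq mult.assoc mult.right_neutral)+
  have E: "2 * ((p * t * x mod k - t * x mod k) + (p * t * y mod k - t * y mod k)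
         + (p * t * z mod k - t * z mod k)) + 2 * (p - 1) * (t mod k) = (p - 1) * k"
    if "coprime t k" for t
    using eq[of "t * \<mu>"] that co m_eq[of t] m_eq[of "p * t"] by (simp add: mult.assoc)
  have "k dvd \<mu> * (a + b + c + d)" using sum by simp
  hence "(\<mu> * a + \<mu> * b + \<mu> * c + \<mu> * d) mod k = 0" by (simp add: algebra_simps)
  moreover have "[x + y + z + 1 = \<mu> * a + \<mu> * b + \<mu> * c + \<mu> * d] (mod k)"
    by (intro cong_add) (use md k(3) in \<open>simp_all add: cong_def x_def y_def z_def\<close>)
  ultimately have "(x + y + z + 1) mod k = 0" by (simp only: cong_def)
  then obtain N where N: "x + y + z + 1 = k * N" by (metis dvdE dvd_eq_mod_eq_0)
  have "k * N > 0" using N xyz by linarith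
  hence N1: "N \<ge> 1" using k(3) by (simp add: zero_less_mult_iff)
  define ex where "ex = p * x mod k"
  define ey where "ey = p * y mod k"
  define ez where "ez = p * z mod k"
  have e: "0 \<le> ex" "ex < k" "0 \<le> ey" "ey < k" "0 \<le> ez" "ez < k"
    using k(3) by (simp_all add: ex_def ey_def ez_def)
  have E1: "2 * (ex + ey + ez) - 2 * (x + y + z) + 2 * (p - 1) = (p - 1) * k"
    using E[of 1] xyz k(3) by (simp add: ex_def ey_def ez_def)
  have kN: "k * 1 \<le> k * N" using N1 k(3) by (intro mult_left_mono) auto
  show False
  proof (cases "p = 5")
    case False
    hence p7: "p \<ge> 7" using p by simp
    have "(p - 1) * k = (p - 7) * (k - 5) + 5 * (p - 7) + 6 * k" by (simp add: algebra_simps)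
    moreover have "(p - 7) * (k - 5) \<ge> 0" using p7 k5 by simp
    ultimately have "6 * k + 5 * (p - 7) \<le> (p - 1) * k" by linarith
    hence "6 * k + 5 * (p - 7) \<le> 2 * (ex + ey + ez) - 2 * (x + y + z) + 2 * (p - 1)" using E1 by simp
    moreover have "x + y + z \<ge> k - 1" using N kN by linarith
    ultimately show False using e p7 k5 by (smt (verit))
  next
    case True
    have "N < 2"
    proof (rule ccontr)
      assume "\<not> N < 2"
      hence "k * 2 \<le> k * N" using k(3) by (intro mult_left_mono) auto
      hence "2 * k \<le> x + y + z + 1" using N by simp
      moreover have "2 * (ex + ey + ez) - 2 * (x + y + z) + 8 = 4 * k" using E1 True by simp
      ultimately show False using e k5 by (smt (verit))
    qed
    hence "N = 1" using N1 by simp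
    hence s: "x + y + z = k - 1" using N by simp
    have es: "ex + ey + ez = 3 * k - 5" using E1 s True by simp
    have "k \<noteq> 5" using k(2) True by auto
    moreover have "k \<noteq> 6" "k \<noteq> 8" "k \<noteq> 9" "k \<noteq> 10" using coprime_6_not_dvd[OF k(1)] by auto
    ultimately have k7: "k = 7 \<or> k \<ge> 11" using k5 by linarith
    show False
    proof (cases "k = 7")
      case True
      \<comment> \<open>The two sum conditions leave only 4, 1, 1 in some order. The multiplier 3 is
        the inverse of 5 modulo 7, so that \<open>5 * 3 * x\<close> in the relation at 3 returns
        \<open>x\<close>.\<close>
      have s11: "3 * x mod 7 + 3 * y mod 7 + 3 * z mod 7 = 11"
      proof -
        have "x = 0 \<or> x = 1 \<or> x = 2 \<or> x = 3 \<or> x = 4 \<or> x = 5 \<or> x = 6"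
          "y = 0 \<or> y = 1 \<or> y = 2 \<or> y = 3 \<or> y = 4 \<or> y = 5 \<or> y = 6"
          using xyz True by presburger+
        moreover have "z = 6 - x - y" "z \<ge> 0" using s xyz True by simp_all
        moreover have "5 * x mod 7 + 5 * y mod 7 + 5 * z mod 7 = 16"
          using es True \<open>p = 5\<close> by (simp add: ex_def ey_def ez_def)
        ultimately show ?thesis by (elim disjE) simp_all
      qed
      have "coprime k (2 * 3)" using k(1) by simp
      hence c3: "coprime 3 k" unfolding coprime_mult_right_iff by (simp add: coprime_commute)
      have c15: "5 * 3 * t mod 7 = t" if "0 \<le> t" "t < k" for t :: int
      proof -
        have "5 * 3 * t = t + 7 * (2 * t)" by simp
        hence "5 * 3 * t mod 7 = t mod 7" by (simp only: mod_mult_self2)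
        thus ?thesis using that True by simp
      qed
      have "2 * ((x - 3 * x mod 7) + (y - 3 * y mod 7) + (z - 3 * z mod 7))
          + 2 * (5 - 1) * (3 mod 7) = (5 - 1) * 7"
        using E[OF c3] c15[OF xyz(1,2)] c15[OF xyz(3,4)] c15[OF xyz(5,6)]
        unfolding \<open>p = 5\<close> True by (simp only:)
      moreover have False
        if "2 * ((x - X) + (y - Y) + (z - Z)) + 2 * (5 - 1) * (3 mod 7) = (5 - 1) * (7::int)"
          "X + Y + Z = 11" for X Y Z
        using that s True by simp
      ultimately show False using s11 by blast
    next
      case False
      hence k11: "k \<ge> 11" using k7 by simp
      have "coprime (-5) k" using k(2) \<open>p = 5\<close> by (simp add: coprime_commute)
      have pos: "ex > 0" "ey > 0" "ez > 0" using es e k11 by linarith+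
      have neg: "(-5) * t mod k = k - f" "5 * (-5) * t mod k = 5 * (k - f) mod k"
        if "f = p * t mod k" "f > 0" for t f
      proof -
        have f: "f = 5 * t mod k" using that \<open>p = 5\<close> by simp
        show "(-5) * t mod k = k - f"
          using that(2) unfolding f by (simp add: zmod_zminus1_eq_if)
        have "[k - f = 0 - 5 * t] (mod k)"
          unfolding f by (intro cong_diff) (simp_all add: cong_def)
        hence "[5 * (k - f) = 5 * (0 - 5 * t)] (mod k)" by (rule cong_scalar_left)
        thus "5 * (-5) * t mod k = 5 * (k - f) mod k" by (simp add: cong_def)
      qed
      have m5: "(-5) mod k = k - 5" using k11 by (simp add: zmod_zminus1_eq_if)
      have "2 * ((5 * (-5) * x mod k - (-5) * x mod k) + (5 * (-5) * y mod k - (-5) * y mod k)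
         + (5 * (-5) * z mod k - (-5) * z mod k)) + 2 * (5 - 1) * ((-5) mod k) = (5 - 1) * k"
        using E[OF \<open>coprime (-5) k\<close>] unfolding \<open>p = 5\<close> .
      hence "2 * ((5 * (k - ex) mod k - (k - ex)) + (5 * (k - ey) mod k - (k - ey))
         + (5 * (k - ez) mod k - (k - ez))) + 2 * (5 - 1) * (k - 5) = (5 - 1) * k"
        unfolding neg[OF ex_def pos(1)] neg[OF ey_def pos(2)] neg[OF ez_def pos(3)] m5 .
      moreover have "2 * (X + Y + Z) = 50 - 4 * k"
        if "2 * ((X - (k - ex)) + (Y - (k - ey)) + (Z - (k - ez))) + 2 * (5 - 1) * (k - 5) = (5 - 1) * k"
        for X Y Z using that es by (simp add: algebra_simps)
      ultimately have le: "2 * (5 * (k - ex) mod k + 5 * (k - ey) mod k + 5 * (k - ez) mod k) = 50 - 4 * k"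
        by blast
      \<comment> \<open>The three positive numbers \<open>k - ex\<close>, \<open>k - ey\<close>,
        \<open>k - ez\<close> add up to 5, so one of them is 1. Its term alone makes the left side
        of \<open>le\<close> at least 10, whereas \<open>50 - 4 * k\<close> is at most 6.\<close>
      have "ex = k - 1 \<or> ey = k - 1 \<or> ez = k - 1" using es e by linarith
      hence "5 * (k - ex) mod k = 5 \<or> 5 * (k - ey) mod k = 5 \<or> 5 * (k - ez) mod k = 5"
        using k11 by auto
      moreover have "0 \<le> 5 * (k - ex) mod k" "0 \<le> 5 * (k - ey) mod k" "0 \<le> 5 * (k - ez) mod k"
        using k11 by simp_all
      ultimately show False using le[unfolded distrib_left] k11 by linarith
    qed
  qed
qed

text \<open>In the class of \<open>p * \<mu>\<close> modulo \<open>k\<close> the shift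
  \<open>j = 0\<close> is the only non-unit, and its residue at \<open>x\<close> is
  \<open>p * (\<mu> * x mod k)\<close>. Subtracting this term from the full class sums and dividing
  by \<open>p\<close> yields the relation refuted in
  \<open>not_balanced_three_nondivisible_aux\<close>.\<close>

lemma not_balanced_three_nondivisible:
  fixes p k a b c d :: int
  assumes k: "k > 1" "coprime (p * k) 6" and p: "prime p" "\<not> p dvd k"
    and nd: "\<not> p dvd a" "\<not> p dvd b" "\<not> p dvd c" and d: "p dvd d" "coprime d k"
    and sum: "k dvd a + b + c + d"
  shows "\<not> balanced (p * k) a b c d"
proof
  assume bal: "balanced (p * k) a b c d"
  have p5: "p \<ge> 5" using coprime_6_ge_5[OF k(2)] p(1) by (simp add: prime_gt_1_int)
  hence p0: "p > 0" by simp
  have k0: "k > 0" using k(1) by simp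
  have "\<not> 2 dvd p" using coprime_6_not_dvd[OF k(2)] by auto
  hence p57: "p = 5 \<or> p \<ge> 7" using p5 by presburger
  have pk: "coprime p k" using p prime_imp_coprime by blast
  have co: "coprime a p" "coprime b p" "coprime c p"
    using nd p(1) prime_imp_coprime coprime_commute by blast+
  show False
  proof (rule not_balanced_three_nondivisible_aux[OF p57 _ _ k(1) d(2) sum])
    fix \<mu> assume mu: "coprime \<mu> k"
    let ?m = "p * \<mu>"
    let ?S = "\<lambda>x. \<Sum>j\<in>{1..<p}. (?m + j * k) * x mod (p * k)"
    have ins: "{0..<p} = insert 0 {1..<p}" using p0 by auto
    have "?S a + ?S b + ?S c + ?S d
        = (\<Sum>j\<in>{1..<p}. (?m + j * k) * a mod (p * k) + (?m + j * k) * b mod (p * k)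
             + (?m + j * k) * c mod (p * k) + (?m + j * k) * d mod (p * k))"
      by (simp add: sum.distrib)
    also have "\<dots> = (\<Sum>j\<in>{1..<p}. 2 * (p * k))"
    proof (intro sum.cong refl balancedD[OF bal] coprime_shift[OF p(1)])
      show "coprime ?m k" using mu pk by simp
      fix j assume "j \<in> {1..<p}"
      hence "\<not> p dvd j" using zdvd_not_zless[of j p] by auto
      hence "\<not> p dvd j * k" using p by (simp add: prime_dvd_mult_iff)
      thus "\<not> p dvd ?m + j * k" by (simp add: dvd_add_right_iff)
    qed
    also have "\<dots> = (p - 1) * (2 * (p * k))" using p0 by simp
    finally have tot: "?S a + ?S b + ?S c + ?S d = (p - 1) * (2 * (p * k))" .
    have mult: "?m * x mod (p * k) = p * (\<mu> * x mod k)" for x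
      by (simp only: mult.assoc mult_mod_right)
    have Sd: "?S d = (p - 1) * (p * (\<mu> * d mod k))"
      using p0 by (simp add: mod_shift_dvd[OF d(1)] mult)
    have Sx: "2 * ?S x = 2 * p * (?m * x mod k) + k * p * (p - 1) - 2 * (p * (\<mu> * x mod k))"
      if "coprime x p" for x
    proof -
      have "(\<Sum>j\<in>{0..<p}. (?m + j * k) * x mod (p * k)) = p * (\<mu> * x mod k) + ?S x"
        unfolding ins by (subst sum.insert) (simp_all add: mult)
      thus ?thesis using sum_mod_shift[OF p0 k0 that, of ?m] by linarith
    qed
    have "2 * ?S a + 2 * ?S b + 2 * ?S c + 2 * ?S d = 2 * ((p - 1) * (2 * (p * k)))" using tot by linarith
    hence "(2 * p * (?m * a mod k) + k * p * (p - 1) - 2 * (p * (\<mu> * a mod k)))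
        + (2 * p * (?m * b mod k) + k * p * (p - 1) - 2 * (p * (\<mu> * b mod k)))
        + (2 * p * (?m * c mod k) + k * p * (p - 1) - 2 * (p * (\<mu> * c mod k)))
        + 2 * ((p - 1) * (p * (\<mu> * d mod k))) = 2 * ((p - 1) * (2 * (p * k)))"
      unfolding Sx[OF co(1)] Sx[OF co(2)] Sx[OF co(3)] Sd .
    moreover have "p * (2 * ((A - A') + (B - B') + (C - C')) + 2 * (p - 1) * D) = p * ((p - 1) * k)"
      if "(2 * p * A + k * p * (p - 1) - 2 * (p * A')) + (2 * p * B + k * p * (p - 1) - 2 * (p * B'))
        + (2 * p * C + k * p * (p - 1) - 2 * (p * C')) + 2 * ((p - 1) * (p * D))
        = 2 * ((p - 1) * (2 * (p * k)))" for A B C D A' B' C'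
      using that by (simp add: algebra_simps)
    ultimately have "p * (2 * ((p * \<mu> * a mod k - \<mu> * a mod k) + (p * \<mu> * b mod k - \<mu> * b mod k)
         + (p * \<mu> * c mod k - \<mu> * c mod k)) + 2 * (p - 1) * (\<mu> * d mod k)) = p * ((p - 1) * k)"
      by blast
    thus "2 * ((p * \<mu> * a mod k - \<mu> * a mod k) + (p * \<mu> * b mod k - \<mu> * b mod k)
         + (p * \<mu> * c mod k - \<mu> * c mod k)) + 2 * (p - 1) * (\<mu> * d mod k) = (p - 1) * k"
      using p0 by simp
  next
    show "coprime k 6" using k(2) by simp
    show "coprime k p" using pk by (simp add: coprime_commute)
  qed
qed

section \<open>Prime powers in the modulus\<close>

text \<open>All members of the class of \<open>m\<close> modulo \<open>k\<close> are units.
  Averaging over them replaces each residue modulo \<open>p * k\<close> by the one modulo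
  \<open>k\<close> plus the same constant \<open>k * (p - 1) / 2\<close>.\<close>

lemma balanced_div_prime:
  fixes p k a b c d :: int
  assumes p: "prime p" "p dvd k" "k > 0"
    and co: "coprime a p" "coprime b p" "coprime c p" "coprime d p"
    and bal: "balanced (p * k) a b c d"
  shows "balanced k a b c d"
  unfolding balanced_def
proof (intro allI impI)
  fix m assume m: "coprime m k"
  have p0: "p > 0" using p(1) by (simp add: prime_gt_0_int)
  let ?S = "\<lambda>x. \<Sum>j\<in>{0..<p}. (m + j * k) * x mod (p * k)"
  have "?S a + ?S b + ?S c + ?S d
      = (\<Sum>j\<in>{0..<p}. (m + j * k) * a mod (p * k) + (m + j * k) * b mod (p * k)
          + (m + j * k) * c mod (p * k) + (m + j * k) * d mod (p * k))"
    by (simp add: sum.distrib)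
  also have "\<dots> = (\<Sum>j\<in>{0..<p}. 2 * (p * k))"
    by (intro sum.cong refl balancedD[OF bal] coprime_shift_sq[OF p(1,2) m])
  also have "\<dots> = 2 * (p * k) * p" using p0 by simp
  finally have tot: "?S a + ?S b + ?S c + ?S d = 2 * (p * k) * p" .
  have Sx: "2 * ?S x = 2 * p * (m * x mod k) + k * p * (p - 1)" if "coprime x p" for x
    by (rule sum_mod_shift[OF p0 p(3) that])
  have "(2 * p * (m * a mod k) + k * p * (p - 1)) + (2 * p * (m * b mod k) + k * p * (p - 1))
     + (2 * p * (m * c mod k) + k * p * (p - 1)) + (2 * p * (m * d mod k) + k * p * (p - 1))
     = 2 * (2 * (p * k) * p)"
    unfolding Sx[OF co(1), symmetric] Sx[OF co(2), symmetric] Sx[OF co(3), symmetric] Sx[OF co(4), symmetric]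
      tot[symmetric] by (simp only: distrib_left)
  hence "(2 * p) * (m * a mod k + m * b mod k + m * c mod k + m * d mod k) = (2 * p) * (2 * k)"
    by (simp add: algebra_simps)
  thus "m * a mod k + m * b mod k + m * c mod k + m * d mod k = 2 * k" using p0 by simp
qed

section \<open>Lifting a cancelling pair by leading digits\<close>

text \<open>A nonempty proper initial segment of the residues modulo \<open>p\<close> is invariant
  under no nonzero translation: it is recognised by its first element 0 together with the
  predecessor \<open>p - 1\<close>, which lies outside.\<close>

lemma initial_segment_shift_eq:
  fixes p s t v :: int
  assumes "0 < v" "v < p" and "\<And>x. (s + x) mod p < v \<longleftrightarrow> (t + x) mod p < v"
  shows "s mod p = t mod p"
proof -
  define r where "r = (t - s) mod p"
  have "(s + - s) mod p < v" using assms by simp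
  hence r1: "r < v" unfolding r_def using assms(3)[of "- s"] by simp
  have "(s + (- s - 1)) mod p = p - 1" using assms by (simp add: zmod_minus1)
  hence "\<not> (s + (- s - 1)) mod p < v" using assms by simp
  hence "\<not> (t + (- s - 1)) mod p < v" using assms(3) by blast
  moreover have "(t + (- s - 1)) mod p = (r - 1) mod p"
    unfolding r_def by (simp add: mod_diff_left_eq algebra_simps)
  ultimately have "\<not> (r - 1) mod p < v" by simp
  moreover have "(r - 1) mod p = r - 1" if "r > 0"
    using that r1 assms by (intro mod_pos_pos_trivial) auto
  moreover have "r \<ge> 0" unfolding r_def using assms by simp
  ultimately have "r = 0" using r1 by linarith
  hence "p dvd t - s" unfolding r_def by auto
  thus ?thesis by (simp add: mod_eq_dvd_iff dvd_diff_commute)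
qed

text \<open>
  The number \<open>(m * x div k + j * x) mod p\<close> is the leading digit of \<open>(m + j * k) * x mod (p * k)\<close> in the
  mixed radix system with digit ranges \<open>p\<close> and \<open>k\<close>.
\<close>

lemma balanced_digit_iff:
  fixes p k u m j a b c d :: int
  assumes p: "prime p" "p dvd k" "k > 0"
    and co: "coprime b p" "coprime c p"
    and bal: "balanced (p * k) a b c d" and u: "a + b = k * u" "\<not> p dvd u"
    and m: "coprime m k"
  shows "(m * a div k + j * a) mod p < m * u mod p \<longleftrightarrow>
         (m * (- c) div k + j * (- c)) mod p < m * u mod p"
proof -
  have p0: "p > 0" using p(1) by (simp add: prime_gt_0_int)
  define n where "n = p * k"
  have n0: "n > 0" using p0 p(3) by (simp add: n_def)
  define m' where "m' = m + j * k"
  have m': "coprime m' n" unfolding m'_def n_def by (rule coprime_shift_sq[OF p(1,2) m])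
  define v where "v = m * u mod p"
  have v: "m' * u mod p = v"
  proof -
    obtain k' where "k = p * k'" using p(2) by blast
    hence "m' * u = m * u + p * (j * k' * u)" by (simp add: m'_def algebra_simps)
    thus ?thesis by (simp add: v_def)
  qed
  have nz: "x * m' mod n > 0" if "coprime x p" for x
  proof -
    have "coprime (x * m') p" using that m' by (auto simp: n_def)
    hence "\<not> p dvd x * m'" using p(1) coprime_common_divisor dvd_refl not_prime_unit by blast
    hence "x * m' mod n \<noteq> 0" by (metis dvd_eq_mod_eq_0 dvd_mult_left n_def)
    thus ?thesis using n0 pos_mod_sign[of n "x * m'"] by linarith
  qed
  define ra where "ra = m' * a mod n"
  define rb where "rb = m' * b mod n"
  define rc where "rc = m' * c mod n"
  define rd where "rd = m' * d mod n"
  have r: "0 \<le> ra" "ra < n" "0 < rb" "rb < n" "0 < rc" "rc < n" "0 \<le> rd" "rd < n"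
    using n0 nz[OF co(1)] nz[OF co(2)] by (simp_all add: ra_def rb_def rc_def rd_def mult.commute)
  have tot: "ra + rb + rc + rd = 2 * n"
    using balancedD[OF bal, of m'] m' by (simp add: ra_def rb_def rc_def rd_def n_def)
  have "(ra + rb) mod n = m' * (a + b) mod n"
    by (simp add: ra_def rb_def mod_add_eq distrib_left)
  also have "\<dots> = k * v"
  proof -
    have "m' * (a + b) = k * (m' * u)" by (simp add: u(1))
    moreover have "k * (m' * u) mod (k * p) = k * (m' * u mod p)" by (rule mult_mod_right[symmetric])
    ultimately show ?thesis unfolding n_def mult.commute[of p k] v by (simp only:)
  qed
  finally have ab: "(ra + rb) mod n = k * v" .
  have v0: "0 \<le> v" "v < p" using p0 by (simp_all add: v_def)
  have "ra + rb = k * v \<or> ra + rb = k * v + n"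
  proof (cases "ra + rb < n")
    case True
    thus ?thesis using ab r by simp
  next
    case False
    have "(ra + rb) mod n = (ra + rb - n) mod n" by simp
    also have "\<dots> = ra + rb - n" using False r by (intro mod_pos_pos_trivial) auto
    finally show ?thesis using ab by simp
  qed
  \<comment> \<open>If \<open>ra + rb = k * v\<close>, both sides hold since \<open>rb > 0\<close>
    and \<open>rd < n\<close>. If \<open>ra + rb = k * v + n\<close>, both fail since
    \<open>rb < n\<close> and \<open>rd \<ge> 0\<close>.\<close>
  hence iff: "ra < k * v \<longleftrightarrow> n - rc < k * v" using r tot by linarith
  have neg: "m' * (- c) mod n = n - rc"
    using r(5) unfolding rc_def by (simp add: zmod_zminus1_eq_if)
  have dig: "m' * x mod n < k * v \<longleftrightarrow> (m * x div k + j * x) mod p < v" for x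
  proof -
    define t where "t = (m * x div k + j * x) mod p"
    define e where "e = m * x mod k"
    have eq: "m' * x mod n = e + k * t"
      unfolding m'_def n_def t_def e_def by (rule mod_shift_digit[OF p0 p(3)])
    have e: "0 \<le> e" "e < k" using p(3) by (simp_all add: e_def)
    have "e + k * t < k * v \<longleftrightarrow> t < v"
    proof
      assume "t < v"
      hence "k * (t + 1) \<le> k * v" using p(3) by simp
      thus "e + k * t < k * v" using e by (simp add: distrib_left)
    next
      assume "e + k * t < k * v"
      hence "k * t < k * v" using e by linarith
      thus "t < v" using p(3) by simp
    qed
    thus ?thesis unfolding eq t_def .
  qed
  have "m' * a mod n < k * v \<longleftrightarrow> m' * (- c) mod n < k * v" using iff unfolding neg ra_def .
  thus ?thesis unfolding dig unfolding v_def .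
qed

text \<open>Equal high digits put the residues of \<open>m * x\<close> and \<open>m * y\<close> at
  distance below \<open>k\<close>, at most n/5, so every unit multiple of \<open>x - y\<close> is
  close to 0 modulo \<open>n\<close>.\<close>

lemma dvd_if_same_digits:
  fixes n p k x y :: int
  assumes n: "n > 0" "coprime n 6" "n = p * k" "prime p" "k > 0"
    and dig: "\<And>m. coprime m n \<Longrightarrow> (m * x div k) mod p = (m * y div k) mod p"
  shows "n dvd x - y"
proof (rule dvd_if_unit_multiples_near_0[OF n(1,2)])
  fix m assume m: "coprime m n"
  have p5: "p \<ge> 5" using coprime_6_ge_5[OF n(2)] n(3,4) by (simp add: prime_gt_1_int)
  have "k * 5 \<le> k * p" using p5 n(5) by simp
  hence k5: "5 * k \<le> n" using n(3) by (simp add: mult.commute)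
  have r: "m * z mod n = m * z mod k + k * ((m * z div k) mod p)" for z
    using mod_shift_digit[of p k m 0 z] p5 n(3,5) by simp
  define e where "e = m * x mod k"
  define f where "f = m * y mod k"
  have ef: "0 \<le> e" "e < k" "0 \<le> f" "f < k" using n(5) by (simp_all add: e_def f_def)
  have "m * (x - y) mod n = (m * x mod n - m * y mod n) mod n"
    by (simp add: right_diff_distrib mod_diff_eq)
  also have "\<dots> = (e - f) mod n"
    unfolding r[of x] r[of y] dig[OF m] e_def f_def by simp
  finally have eq: "m * (x - y) mod n = (e - f) mod n" .
  show "5 * (m * (x - y) mod n) < 2 * n \<or> 3 * n \<le> 5 * (m * (x - y) mod n)"
  proof (cases "e \<ge> f")
    case True
    hence "(e - f) mod n = e - f" using ef k5 by (intro mod_pos_pos_trivial) auto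
    thus ?thesis unfolding eq using ef k5 by linarith
  next
    case False
    have "(e - f) mod n = (e - f + n) mod n" by simp
    also have "\<dots> = e - f + n" using False ef k5 by (intro mod_pos_pos_trivial) auto
    finally show ?thesis unfolding eq using ef k5 by linarith
  qed
qed

text \<open>As \<open>a\<close> and \<open>- c\<close> agree modulo \<open>p\<close>, a shift
  \<open>j\<close> translates their high digits equally. By \<open>balanced_digit_iff\<close> the
  two digits enter the same initial segment simultaneously, and its length
  \<open>m * u mod p\<close> is nonzero because \<open>p * k\<close> does not divide
  \<open>a + b\<close>. So the digits are equal for every unit \<open>m\<close>.\<close>

lemma balanced_pair_lift_aux:
  fixes p k a b c d :: int
  assumes n: "coprime (p * k) 6" and p: "prime p" "p dvd k" "k > 0"
    and co: "coprime a p" "coprime b p" "coprime c p"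
    and bal: "balanced (p * k) a b c d"
    and ab: "k dvd a + b" "\<not> p * k dvd a + b" and ac: "p dvd a + c"
  shows "p * k dvd a + c"
proof -
  have p0: "p > 0" using p(1) by (simp add: prime_gt_0_int)
  obtain u where u: "a + b = k * u" using ab(1) by blast
  have pu: "\<not> p dvd u" using ab(2) u by (metis dvd_refl mult.commute mult_dvd_mono)
  have "p * k dvd a - (- c)"
  proof (rule dvd_if_same_digits[OF _ n refl p(1,3)])
    show "p * k > 0" using p0 p(3) by simp
    fix m assume "coprime m (p * k)"
    hence m: "coprime m k" "coprime m p" by simp_all
    have v: "0 < m * u mod p" "m * u mod p < p"
    proof -
      have "\<not> p dvd m" using m(2) p(1) coprime_common_divisor dvd_refl not_prime_unit by blast
      hence "\<not> p dvd m * u" using pu p(1) by (simp add: prime_dvd_mult_iff)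
      hence "m * u mod p \<noteq> 0" by auto
      thus "0 < m * u mod p" using p0 pos_mod_sign[of p "m * u"] by linarith
    qed (use p0 in simp)
    show "(m * a div k) mod p = (m * (- c) div k) mod p"
    proof (rule initial_segment_shift_eq[OF v])
      fix x
      obtain a' where a': "[a * a' = 1] (mod p)" using cong_solve_coprime_int co(1) by blast
      define j where "j = x * a'"
      have ja: "[j * a = x] (mod p)"
        using cong_scalar_left[OF a', of x] by (simp add: j_def mult_ac)
      have "[a = - c] (mod p)" using ac by (simp add: cong_iff_dvd_diff)
      hence "[j * a = j * (- c)] (mod p)" by (rule cong_scalar_left)
      hence jc: "[j * (- c) = x] (mod p)" using ja cong_trans cong_sym by blast
      have "(m * a div k + j * a) mod p = (m * a div k + x) mod p"
        "(m * (- c) div k + j * (- c)) mod p = (m * (- c) div k + x) mod p"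
        using cong_add[OF cong_refl ja] cong_add[OF cong_refl jc] by (auto simp: cong_def)
      thus "(m * a div k + x) mod p < m * u mod p \<longleftrightarrow> (m * (- c) div k + x) mod p < m * u mod p"
        using balanced_digit_iff[OF p co(2,3) bal u pu m(1), of j] by presburger
    qed
  qed
  thus ?thesis by simp
qed

text \<open>With \<open>m\<close> chosen so that the segment of \<open>balanced_digit_iff\<close> is
  {0, 1}, the affine map from the high digit of \<open>a\<close> to that of \<open>- c\<close>
  preserves {0, 1}. Its slope - c/a modulo \<open>p\<close> is therefore 1 or -1, so
  \<open>c\<close> is \<open>- a\<close> or \<open>a\<close> modulo \<open>p\<close>. The auxiliary
  lemma applies to \<open>a\<close>, \<open>c\<close> in the first case and to \<open>b\<close>,
  \<open>c\<close> in the second.\<close>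

lemma balanced_pair_lift:
  fixes p k a b c d :: int
  assumes n: "coprime (p * k) 6" and p: "prime p" "p dvd k" "k > 0"
    and co: "coprime a p" "coprime b p" "coprime c p"
    and sum: "p * k dvd a + b + c + d" and bal: "balanced (p * k) a b c d"
    and ab: "k dvd a + b"
  shows "p * k dvd a + b \<or> p * k dvd a + c \<or> p * k dvd a + d"
proof (cases "p * k dvd a + b")
  case False
  have p0: "p > 0" using p(1) by (simp add: prime_gt_0_int)
  have p5: "p \<ge> 5" using coprime_6_ge_5[OF n] p(1) by (simp add: prime_gt_1_int)
  obtain u where u: "a + b = k * u" using ab(1) by blast
  have pu: "\<not> p dvd u" using False u by (metis dvd_refl mult.commute mult_dvd_mono)
  hence "coprime u p" using p(1) prime_imp_coprime coprime_commute by blast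
  then obtain u' where u': "[u * u' = 1] (mod p)" using cong_solve_coprime_int by blast
  have "coprime 2 p" using p5 p(1) primes_coprime[of 2 p] by simp
  moreover have "coprime u' p" using u' \<open>coprime u p\<close>
    by (metis cong_imp_coprime cong_sym coprime_1_left coprime_mult_left_iff)
  ultimately have "coprime (2 * u') p" by simp
  then obtain m where m: "coprime m k" "[m = 2 * u'] (mod p)"
    using coprime_lift[of "2 * u'" p k] p(2,3) by auto
  have "[m * u = 2 * u' * u] (mod p)" using m(2) by (rule cong_scalar_right)
  moreover have "[2 * u' * u = 2] (mod p)" using cong_scalar_left[OF u', of 2] by (simp add: mult_ac)
  ultimately have "[m * u = 2] (mod p)" by (rule cong_trans)
  hence v: "m * u mod p = 2" using p5 by (simp add: cong_def)
  define s where "s = m * a div k"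
  define t where "t = m * (- c) div k"
  have iff: "(s + j * a) mod p < 2 \<longleftrightarrow> (t + j * (- c)) mod p < 2" for j
    using balanced_digit_iff[OF p co(2,3) bal u pu m(1), of j] unfolding v s_def t_def .
  obtain a' where a': "[a * a' = 1] (mod p)" using cong_solve_coprime_int co(1) by blast
  have hit: "(s + ((x - s) * a') * a) mod p = x mod p" for x
  proof -
    have "[(x - s) * (a * a') = (x - s) * 1] (mod p)" using a' by (rule cong_scalar_left)
    hence "[s + ((x - s) * a') * a = s + (x - s)] (mod p)"
      by (intro cong_add cong_refl) (simp add: mult_ac)
    thus ?thesis by (simp add: cong_def)
  qed
  define x where "x = (t + ((0 - s) * a') * (- c)) mod p"
  define y where "y = (t + ((1 - s) * a') * (- c)) mod p"
  have "x < 2" "y < 2" unfolding x_def y_def iff[symmetric] hit using p5 by simp_all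
  moreover have "0 \<le> x" "0 \<le> y" unfolding x_def y_def using p0 by simp_all
  \<comment> \<open>\<open>x\<close> and \<open>y\<close> are the images of 0 and 1, so their
    difference is the slope; the value 0 is excluded later because \<open>p\<close> does not divide
    \<open>c\<close>.\<close>
  ultimately have xy: "y - x = 0 \<or> y - x = 1 \<or> y - x = -1" by linarith
  have "[y - x = (t + ((1 - s) * a') * (- c)) - (t + ((0 - s) * a') * (- c))] (mod p)"
    unfolding x_def y_def by (intro cong_diff) (simp_all add: cong_def)
  hence yx: "[y - x = - (a' * c)] (mod p)" by (simp add: algebra_simps)
  hence "[a * (y - x) = a * - (a' * c)] (mod p)" by (rule cong_scalar_left)
  moreover have "[a * - (a' * c) = - c] (mod p)"
    using cong_scalar_right[OF a', of "- c"] by (simp add: mult_ac)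
  ultimately have "[a * (y - x) = - c] (mod p)" by (rule cong_trans)
  hence d: "p dvd a * (y - x) + c" by (simp add: cong_iff_dvd_diff)
  have "\<not> p dvd c" using co(3) p(1) coprime_common_divisor dvd_refl not_prime_unit by blast
  hence "p dvd a + c \<or> p dvd c - a" using d xy by auto
  thus ?thesis
  proof
    assume "p dvd a + c"
    thus ?thesis using balanced_pair_lift_aux[OF n p co bal ab False] by simp
  next
    assume "p dvd c - a"
    moreover have "p dvd a + b" using p(2) ab dvd_trans by blast
    ultimately have "p dvd b + c" using dvd_add[of p "c - a" "a + b"] by (simp add: algebra_simps)
    moreover have "balanced (p * k) b a c d" using bal by (simp add: balanced_def add_ac)
    ultimately have "p * k dvd b + c"
      using balanced_pair_lift_aux[OF n p co(2,1,3), of d] ab False by (simp add: add.commute)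
    hence "p * k dvd a + d" using sum by (metis add.assoc add.commute dvd_add_right_iff)
    thus ?thesis by simp
  qed
qed simp

section \<open>Moments of residues over a class of units\<close>

lemma power_diff_cong_square:
  fixes u n f :: int
  shows "[(u - n * f) ^ Suc k = u ^ Suc k - (int k + 1) * n * u ^ k * f] (mod n\<^sup>2)"
proof (induction k)
  case (Suc k)
  have "[(u - n * f) ^ Suc k * (u - n * f) = (u ^ Suc k - (int k + 1) * n * u ^ k * f) * (u - n * f)] (mod n\<^sup>2)"
    using Suc by (rule cong_scalar_right)
  moreover have "(u ^ Suc k - (int k + 1) * n * u ^ k * f) * (u - n * f)
     = (u ^ Suc (Suc k) - (int (Suc k) + 1) * n * u ^ Suc k * f) + n\<^sup>2 * ((int k + 1) * u ^ k * f ^ 2)"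
    by (simp add: algebra_simps power2_eq_square)
  ultimately show ?case by (simp add: cong_def mult.commute)
qed simp

text \<open>\<open>P\<close> will be the smaller prime, or 1 with \<open>c = 0\<close> for a prime
  modulus. For \<open>c\<close> coprime to \<open>P\<close> the members are units modulo
  \<open>P * q\<close>.\<close>

definition unit_class :: "int \<Rightarrow> int \<Rightarrow> int \<Rightarrow> int set" where
  "unit_class P q c = {m \<in> {0..<P * q}. m mod P = c \<and> \<not> q dvd m}"

definition class_moment :: "int \<Rightarrow> int \<Rightarrow> nat \<Rightarrow> int \<Rightarrow> int" where
  "class_moment P q j c = (\<Sum>m\<in>unit_class P q c. m ^ j)"

text \<open>The full class consists of the numbers \<open>c + P * t\<close>. The members left out of
  \<open>unit_class\<close> are multiples of \<open>q\<close>, whose \<open>j\<close>-th powers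
  vanish modulo \<open>q ^ j\<close>.\<close>

lemma class_moment_cong:
  fixes P q c :: int
  assumes "P > 0" "q > 0" "0 \<le> c" "c < P"
  shows "[class_moment P q j c = (\<Sum>t\<in>{0..<q}. (c + P * t) ^ j)] (mod q ^ j)"
proof -
  let ?A = "(\<lambda>t. c + P * t) ` {0..<q}"
  have A: "?A = {m \<in> {0..<P * q}. m mod P = c}"
  proof (intro equalityI subsetI)
    fix m assume "m \<in> ?A"
    then obtain t where t: "0 \<le> t" "t < q" "m = c + P * t" by auto
    have "P * (t + 1) \<le> P * q" using t assms by (intro mult_left_mono) auto
    hence "c + P * t < P * q" using assms by (simp add: algebra_simps)
    moreover have "0 \<le> P * t" using t assms by simp
    ultimately show "m \<in> {m \<in> {0..<P * q}. m mod P = c}" using t assms by simp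
  next
    fix m assume "m \<in> {m \<in> {0..<P * q}. m mod P = c}"
    hence m: "0 \<le> m" "m < P * q" "m mod P = c" by auto
    have e: "m = c + P * (m div P)" using m(3) by (metis mult_div_mod_eq add.commute)
    moreover have "0 \<le> m div P" using m assms by (simp add: pos_imp_zdiv_nonneg_iff)
    moreover have "P * (m div P) < P * q" using e m(2) assms(3) by linarith
    hence "m div P < q" using assms(1) by simp
    ultimately show "m \<in> ?A" by (intro image_eqI[of _ _ "m div P"]) auto
  qed
  have inj: "inj_on (\<lambda>t. c + P * t) {0..<q}" using assms by (auto simp: inj_on_def)
  have fin: "finite ?A" by simp
  have "(\<Sum>t\<in>{0..<q}. (c + P * t) ^ j) = (\<Sum>m\<in>?A. m ^ j)"
    by (simp add: sum.reindex[OF inj])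
  also have "\<dots> = (\<Sum>m\<in>?A - unit_class P q c. m ^ j) + class_moment P q j c"
    unfolding class_moment_def
    by (rule sum.subset_diff[OF _ fin]) (auto simp: A unit_class_def)
  finally have "(\<Sum>t\<in>{0..<q}. (c + P * t) ^ j) - class_moment P q j c
      = (\<Sum>m\<in>?A - unit_class P q c. m ^ j)" by simp
  moreover have "q ^ j dvd (\<Sum>m\<in>?A - unit_class P q c. m ^ j)"
    by (rule dvd_sum) (auto simp: A unit_class_def intro: dvd_power_same)
  ultimately have "q ^ j dvd (\<Sum>t\<in>{0..<q}. (c + P * t) ^ j) - class_moment P q j c" by simp
  thus ?thesis by (simp add: cong_iff_dvd_diff dvd_diff_commute)
qed

lemma bij_betw_unit_class:
  fixes P q c x :: int
  assumes "P > 0" "prime q" "coprime x (P * q)" "0 \<le> c" "c < P"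
  shows "bij_betw (\<lambda>m. m * x mod (P * q)) (unit_class P q c) (unit_class P q (c * x mod P))"
proof -
  let ?n = "P * q"
  have q0: "q > 0" using assms(2) by (simp add: prime_gt_0_int)
  have n0: "?n > 0" using q0 assms by simp
  obtain y where y: "[x * y = 1] (mod ?n)" using cong_solve_coprime_int assms(3) by blast
  have yP: "[x * y = 1] (mod P)" using y by (rule cong_dvd_modulus) simp
  have maps: "m * z mod ?n \<in> unit_class P q (c' * z mod P)"
    if m: "m \<in> unit_class P q c'" and z: "coprime z q" for m z c'
  proof -
    have "\<not> q dvd z" using z assms(2) coprime_common_divisor dvd_refl not_prime_unit by blast
    moreover have "\<not> q dvd m" "m mod P = c'" using m by (auto simp: unit_class_def)
    ultimately have "\<not> q dvd m * z" using assms(2) by (simp add: prime_dvd_mult_iff)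
    hence "\<not> q dvd m * z mod ?n" by (simp add: dvd_mod_iff)
    moreover have "m * z mod ?n mod P = c' * z mod P"
      using \<open>m mod P = c'\<close> by (simp add: mod_mod_cancel) (metis mod_mult_left_eq)
    ultimately show ?thesis using n0 by (simp add: unit_class_def)
  qed
  have inv: "m * z mod ?n * w mod ?n = m" if "[z * w = 1] (mod ?n)" "0 \<le> m" "m < ?n" for m z w
  proof -
    have "[m * (z * w) = m * 1] (mod ?n)" using that(1) by (rule cong_scalar_left)
    hence "m * z * w mod ?n = m" using that by (simp add: cong_def mult.assoc)
    thus ?thesis by (simp add: mod_mult_left_eq)
  qed
  have xq: "coprime x q" using assms(3) by simp
  have "[x * y = 1] (mod q)" using y by (rule cong_dvd_modulus) simp
  hence yq: "coprime y q" by (metis cong_imp_coprime cong_sym coprime_1_left coprime_mult_left_iff)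
  show ?thesis
  proof (rule bij_betw_byWitness[where f' = "\<lambda>m. m * y mod ?n"])
    show "\<forall>m\<in>unit_class P q c. m * x mod ?n * y mod ?n = m"
      using inv[OF y] by (auto simp: unit_class_def)
    show "\<forall>m\<in>unit_class P q (c * x mod P). m * y mod ?n * x mod ?n = m"
      using inv[of y x] y by (auto simp: unit_class_def mult.commute)
    show "(\<lambda>m. m * x mod ?n) ` unit_class P q c \<subseteq> unit_class P q (c * x mod P)"
      using maps[OF _ xq] by blast
    have "[c * (x * y) = c * 1] (mod P)" using yP by (rule cong_scalar_left)
    hence "(c * x mod P) * y mod P = c"
      using assms by (simp add: cong_def mod_mult_left_eq mult.assoc)
    thus "(\<lambda>m. m * y mod ?n) ` unit_class P q (c * x mod P) \<subseteq> unit_class P q c"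
      using maps[OF _ yq, of _ "c * x mod P"] by auto
  qed
qed

text \<open>Multiplication by \<open>x\<close> permutes the classes, so the moment at
  \<open>c * x\<close> is a sum of powers of \<open>m * x mod n = m * x - n * (m * x div n)\<close>,
  where \<open>n = P * q\<close>. Modulo the square of \<open>q\<close> the expansion is linear in
  the quotient, and \<open>y ^ k\<close> cancels \<open>x ^ k\<close>. Linearity is what lets four
  such sums be added by means of the balance equation.\<close>

lemma class_moment_mult_cong:
  fixes P q c x y :: int
  assumes "P > 0" "prime q" "coprime x (P * q)" "0 \<le> c" "c < P" and y: "[x * y = 1] (mod q\<^sup>2)"
  shows "[y ^ k * class_moment P q (Suc k) (c * x mod P)
      = x * class_moment P q (Suc k) c
        - (int k + 1) * (\<Sum>m\<in>unit_class P q c. m ^ k * (P * q * (m * x div (P * q))))] (mod q\<^sup>2)"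
proof -
  let ?n = "P * q"
  let ?M = "unit_class P q c"
  let ?f = "\<lambda>m. m * x div ?n"
  have dvd: "q\<^sup>2 dvd ?n\<^sup>2" by (simp add: power_mult_distrib)
  have "class_moment P q (Suc k) (c * x mod P) = (\<Sum>m\<in>?M. (m * x mod ?n) ^ Suc k)"
    unfolding class_moment_def
    by (rule sum.reindex_bij_betw[OF bij_betw_unit_class[OF assms(1-5)], symmetric])
  hence "y ^ k * class_moment P q (Suc k) (c * x mod P) = (\<Sum>m\<in>?M. y ^ k * (m * x mod ?n) ^ Suc k)"
    by (simp only: sum_distrib_left)
  moreover have "[(\<Sum>m\<in>?M. y ^ k * (m * x mod ?n) ^ Suc k)
      = (\<Sum>m\<in>?M. x * m ^ Suc k - (int k + 1) * (m ^ k * (?n * ?f m)))] (mod q\<^sup>2)"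
  proof (rule cong_sum)
    fix m
    have e: "m * x mod ?n = m * x - ?n * ?f m" by (simp add: minus_mult_div_eq_mod)
    have "[(m * x mod ?n) ^ Suc k = (m * x) ^ Suc k - (int k + 1) * ?n * (m * x) ^ k * ?f m] (mod q\<^sup>2)"
      unfolding e by (rule cong_dvd_modulus[OF power_diff_cong_square dvd])
    hence "[y ^ k * (m * x mod ?n) ^ Suc k
        = y ^ k * ((m * x) ^ Suc k - (int k + 1) * ?n * (m * x) ^ k * ?f m)] (mod q\<^sup>2)"
      by (rule cong_scalar_left)
    also have "y ^ k * ((m * x) ^ Suc k - (int k + 1) * ?n * (m * x) ^ k * ?f m)
        = (x * y) ^ k * (x * m ^ Suc k - (int k + 1) * (m ^ k * (?n * ?f m)))"
      by (simp add: power_mult_distrib right_diff_distrib mult_ac)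
    also have "[\<dots> = 1 ^ k * (x * m ^ Suc k - (int k + 1) * (m ^ k * (?n * ?f m)))] (mod q\<^sup>2)"
      by (intro cong_scalar_right cong_pow y)
    finally show "[y ^ k * (m * x mod ?n) ^ Suc k
        = x * m ^ Suc k - (int k + 1) * (m ^ k * (?n * ?f m))] (mod q\<^sup>2)" by simp
  qed
  moreover have "(\<Sum>m\<in>?M. x * m ^ Suc k - (int k + 1) * (m ^ k * (?n * ?f m)))
      = x * class_moment P q (Suc k) c - (int k + 1) * (\<Sum>m\<in>?M. m ^ k * (?n * ?f m))"
    by (simp only: sum_subtractf sum_distrib_left class_moment_def)
  ultimately show ?thesis by simp
qed

text \<open>
  Here \<open>N\<close> clears the denominator of the Bernoulli polynomial \<open>B\<^bsub>k+1\<^esub>\<close>, and \<open>w s\<close> is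
  \<open>N * P ^ (k + 1) * B\<^bsub>k+1\<^esub> (s / P)\<close>.
\<close>

lemma moment_relation:
  fixes P q c a b d e A B D E N :: int and w :: "int \<Rightarrow> int"
  assumes P: "P > 0" and q: "prime q" and c: "0 \<le> c" "c < P" "coprime c P"
    and co: "coprime a (P * q)" "coprime b (P * q)" "coprime d (P * q)" "coprime e (P * q)"
    and inv: "[a * A = 1] (mod q\<^sup>2)" "[b * B = 1] (mod q\<^sup>2)" "[d * D = 1] (mod q\<^sup>2)" "[e * E = 1] (mod q\<^sup>2)"
    and sum: "P * q dvd a + b + d + e" and bal: "balanced (P * q) a b d e"
    and k: "k > 0" and N: "coprime N q"
    and T: "\<And>s. q dvd (\<Sum>t\<in>{0..<q}. (s + P * t) ^ k)"
    and W: "\<And>s. [N * (\<Sum>t\<in>{0..<q}. (s + P * t) ^ Suc k) = q * w s] (mod q\<^sup>2)"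
  shows "q dvd A ^ k * w (c * a mod P) + B ^ k * w (c * b mod P)
             + D ^ k * w (c * d mod P) + E ^ k * w (c * e mod P)"
proof -
  let ?n = "P * q"
  let ?M = "unit_class P q c"
  let ?V = "class_moment P q"
  have q0: "q > 0" using q by (simp add: prime_gt_0_int)
  have Vk: "q dvd ?V k s" if "0 \<le> s" "s < P" for s
  proof -
    have "[?V k s = (\<Sum>t\<in>{0..<q}. (s + P * t) ^ k)] (mod q ^ k)"
      using class_moment_cong P q0 that by blast
    hence "[?V k s = (\<Sum>t\<in>{0..<q}. (s + P * t) ^ k)] (mod q)"
      by (rule cong_dvd_modulus) (use k in \<open>simp add: dvd_power\<close>)
    thus ?thesis using T cong_dvd_iff by blast
  qed
  have NV: "[N * ?V (Suc k) s = q * w s] (mod q\<^sup>2)" if "0 \<le> s" "s < P" for s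
  proof -
    have "[?V (Suc k) s = (\<Sum>t\<in>{0..<q}. (s + P * t) ^ Suc k)] (mod q ^ Suc k)"
      using class_moment_cong P q0 that by blast
    hence "[?V (Suc k) s = (\<Sum>t\<in>{0..<q}. (s + P * t) ^ Suc k)] (mod q\<^sup>2)"
    proof (rule cong_dvd_modulus)
      show "q\<^sup>2 dvd q ^ Suc k" using k by (intro le_imp_power_dvd) simp
    qed
    hence "[N * ?V (Suc k) s = N * (\<Sum>t\<in>{0..<q}. (s + P * t) ^ Suc k)] (mod q\<^sup>2)"
      by (rule cong_scalar_left)
    thus ?thesis using W cong_trans by blast
  qed
  have VSk: "q dvd ?V (Suc k) c"
  proof -
    have "[N * ?V (Suc k) c = q * w c] (mod q)"
      using NV[OF c(1,2)] by (rule cong_dvd_modulus) (simp add: power2_eq_square)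
    hence "q dvd N * ?V (Suc k) c \<longleftrightarrow> q dvd q * w c" by (rule cong_dvd_iff)
    hence "q dvd N * ?V (Suc k) c" by simp
    thus ?thesis using N by (metis coprime_commute coprime_dvd_mult_right_iff)
  qed
  define G where "G = (\<lambda>x. \<Sum>m\<in>?M. m ^ k * (?n * (m * x div ?n)))"
  \<comment> \<open>For each unit \<open>m\<close> the balance equation evaluates the sum of the
    four quotients, multiplied by \<open>P * q\<close>, as
    \<open>m * (a + b + d + e) - 2 * P * q\<close>.\<close>
  have G: "G a + G b + G d + G e = (a + b + d + e) * ?V (Suc k) c - 2 * ?n * ?V k c"
  proof -
    have "m ^ k * (?n * (m * a div ?n)) + m ^ k * (?n * (m * b div ?n))
        + m ^ k * (?n * (m * d div ?n)) + m ^ k * (?n * (m * e div ?n))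
        = (a + b + d + e) * m ^ Suc k - 2 * ?n * m ^ k"
      if "m \<in> ?M" for m
    proof -
      have m: "m mod P = c" "\<not> q dvd m" using that by (auto simp: unit_class_def)
      have "coprime m P" using m(1) c(3) by (metis coprime_mod_left_iff P less_irrefl)
      moreover have "coprime m q" using m(2) q prime_imp_coprime coprime_commute by blast
      ultimately have "coprime m ?n" by simp
      from balancedD[OF bal this]
      have "(m * a - ?n * (m * a div ?n)) + (m * b - ?n * (m * b div ?n))
         + (m * d - ?n * (m * d div ?n)) + (m * e - ?n * (m * e div ?n)) = 2 * ?n"
        by (simp only: minus_mult_div_eq_mod)
      hence "?n * (m * a div ?n) + ?n * (m * b div ?n) + ?n * (m * d div ?n) + ?n * (m * e div ?n)
         = m * (a + b + d + e) - 2 * ?n" by (simp only: distrib_left)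
      hence "m ^ k * (?n * (m * a div ?n) + ?n * (m * b div ?n) + ?n * (m * d div ?n) + ?n * (m * e div ?n))
         = m ^ k * (m * (a + b + d + e) - 2 * ?n)" by (simp only:)
      thus ?thesis by (simp add: algebra_simps)
    qed
    hence "(\<Sum>m\<in>?M. m ^ k * (?n * (m * a div ?n)) + m ^ k * (?n * (m * b div ?n))
        + m ^ k * (?n * (m * d div ?n)) + m ^ k * (?n * (m * e div ?n)))
        = (\<Sum>m\<in>?M. (a + b + d + e) * m ^ Suc k - 2 * ?n * m ^ k)"
      by (rule sum.cong[OF refl])
    thus ?thesis
      by (simp only: G_def sum.distrib sum_subtractf sum_distrib_left class_moment_def)
  qed
  define F where "F = (\<lambda>x y. y ^ k * ?V (Suc k) (c * x mod P))"
  have Fx: "[F x y = x * ?V (Suc k) c - (int k + 1) * G x] (mod q\<^sup>2)"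
    if "coprime x ?n" "[x * y = 1] (mod q\<^sup>2)" for x y
    unfolding F_def G_def by (rule class_moment_mult_cong[OF P q that(1) c(1,2) that(2)])
  have "[F a A + F b B + F d D + F e E =
      (a * ?V (Suc k) c - (int k + 1) * G a) + (b * ?V (Suc k) c - (int k + 1) * G b)
      + (d * ?V (Suc k) c - (int k + 1) * G d) + (e * ?V (Suc k) c - (int k + 1) * G e)] (mod q\<^sup>2)"
    by (intro cong_add Fx co inv)
  also have "(a * ?V (Suc k) c - (int k + 1) * G a) + (b * ?V (Suc k) c - (int k + 1) * G b)
      + (d * ?V (Suc k) c - (int k + 1) * G d) + (e * ?V (Suc k) c - (int k + 1) * G e)
      = (a + b + d + e) * ?V (Suc k) c - (int k + 1) * (G a + G b + G d + G e)"
    by (simp add: algebra_simps)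
  also have "\<dots> = 2 * (int k + 1) * ?n * ?V k c - int k * (a + b + d + e) * ?V (Suc k) c"
    unfolding G by (simp add: algebra_simps)
  \<comment> \<open>Each term contains \<open>q\<close> twice: once in \<open>P * q\<close> and in
    the \<open>k\<close>-th moment, once in \<open>a + b + d + e\<close> and in the next
    moment.\<close>
  also have "[\<dots> = 0] (mod q\<^sup>2)"
  proof -
    have "q dvd a + b + d + e" using sum dvd_mult_right by blast
    hence "q * q dvd (a + b + d + e) * ?V (Suc k) c" using VSk by (rule mult_dvd_mono)
    hence 1: "q\<^sup>2 dvd int k * (a + b + d + e) * ?V (Suc k) c"
      by (simp add: power2_eq_square mult.assoc)
    have "q * q dvd ?n * ?V k c" using Vk[OF c(1,2)] by (intro mult_dvd_mono) auto
    hence "q\<^sup>2 dvd 2 * (int k + 1) * (?n * ?V k c)" by (simp add: power2_eq_square)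
    hence "q\<^sup>2 dvd 2 * (int k + 1) * ?n * ?V k c" by (simp only: mult.assoc)
    thus ?thesis using 1 by (simp add: cong_0_iff)
  qed
  finally have "[N * (F a A + F b B + F d D + F e E) = N * 0] (mod q\<^sup>2)" by (rule cong_scalar_left)
  hence N0: "[N * F a A + N * F b B + N * F d D + N * F e E = 0] (mod q\<^sup>2)"
    by (simp only: distrib_left mult_zero_right)
  have NF: "[N * F x y = q * (y ^ k * w (c * x mod P))] (mod q\<^sup>2)" for x y
  proof -
    have "[y ^ k * (N * ?V (Suc k) (c * x mod P)) = y ^ k * (q * w (c * x mod P))] (mod q\<^sup>2)"
      by (intro cong_scalar_left NV) (use P in simp_all)
    thus ?thesis by (simp add: F_def mult_ac)
  qed
  have "[N * F a A + N * F b B + N * F d D + N * F e E =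
      q * (A ^ k * w (c * a mod P)) + q * (B ^ k * w (c * b mod P))
      + q * (D ^ k * w (c * d mod P)) + q * (E ^ k * w (c * e mod P))] (mod q\<^sup>2)"
    by (intro cong_add NF)
  from cong_trans[OF cong_sym[OF this] N0] have "[q * (A ^ k * w (c * a mod P)) + q * (B ^ k * w (c * b mod P))
      + q * (D ^ k * w (c * d mod P)) + q * (E ^ k * w (c * e mod P)) = 0] (mod q\<^sup>2)" .
  hence "q * q dvd q * (A ^ k * w (c * a mod P) + B ^ k * w (c * b mod P)
      + D ^ k * w (c * d mod P) + E ^ k * w (c * e mod P))"
    by (simp add: cong_0_iff power2_eq_square distrib_left)
  thus ?thesis using q0 by simp
qed

section \<open>Power sums and the first three moment relations\<close>

text \<open>These are Faulhaber formulas with cleared denominators. The factor \<open>q\<close> is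
  split off so that divisibility by \<open>q\<close> and the value modulo the square of
  \<open>q\<close> can be read off.\<close>

lemma class_power_sums:
  fixes P q s :: int
  assumes "q \<ge> 0"
  shows "2 * (\<Sum>t\<in>{0..<q}. (s + P * t) ^ 1) = q * (2 * s + P * (q - 1))"
    and "6 * (\<Sum>t\<in>{0..<q}. (s + P * t) ^ 2) = q * (6 * s\<^sup>2 + 6 * s * P * (q - 1) + P\<^sup>2 * (q - 1) * (2 * q - 1))"
    and "4 * (\<Sum>t\<in>{0..<q}. (s + P * t) ^ 3)
      = q * (4 * s ^ 3 + 6 * s\<^sup>2 * P * (q - 1) + 2 * s * P\<^sup>2 * (q - 1) * (2 * q - 1) + P ^ 3 * q * (q - 1)\<^sup>2)"
    and "30 * (\<Sum>t\<in>{0..<q}. (s + P * t) ^ 4)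
      = q * (30 * s ^ 4 + 60 * s ^ 3 * P * (q - 1) + 30 * s\<^sup>2 * P\<^sup>2 * (q - 1) * (2 * q - 1)
         + 30 * s * P ^ 3 * q * (q - 1)\<^sup>2 + P ^ 4 * (q - 1) * (2 * q - 1) * (3 * q\<^sup>2 - 3 * q - 1))"
proof -
  have ins: "{0..<p + 1} = insert p {0..<p}" if "0 \<le> p" for p :: int using that by auto
  show "2 * (\<Sum>t\<in>{0..<q}. (s + P * t) ^ 1) = q * (2 * s + P * (q - 1))"
    using assms by (induction q rule: int_ge_induct) (simp_all add: ins algebra_simps)
  show "6 * (\<Sum>t\<in>{0..<q}. (s + P * t) ^ 2) = q * (6 * s\<^sup>2 + 6 * s * P * (q - 1) + P\<^sup>2 * (q - 1) * (2 * q - 1))"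
    using assms
    by (induction q rule: int_ge_induct) (simp_all add: ins algebra_simps eval_nat_numeral)
  show "4 * (\<Sum>t\<in>{0..<q}. (s + P * t) ^ 3)
      = q * (4 * s ^ 3 + 6 * s\<^sup>2 * P * (q - 1) + 2 * s * P\<^sup>2 * (q - 1) * (2 * q - 1) + P ^ 3 * q * (q - 1)\<^sup>2)"
    using assms
    by (induction q rule: int_ge_induct) (simp_all add: ins algebra_simps eval_nat_numeral)
  show "30 * (\<Sum>t\<in>{0..<q}. (s + P * t) ^ 4)
      = q * (30 * s ^ 4 + 60 * s ^ 3 * P * (q - 1) + 30 * s\<^sup>2 * P\<^sup>2 * (q - 1) * (2 * q - 1)
         + 30 * s * P ^ 3 * q * (q - 1)\<^sup>2 + P ^ 4 * (q - 1) * (2 * q - 1) * (3 * q\<^sup>2 - 3 * q - 1))"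
    using assms
    by (induction q rule: int_ge_induct) (simp_all add: ins algebra_simps eval_nat_numeral)
qed

text \<open>\<open>w1\<close>, \<open>2 * w2\<close> and \<open>w3\<close> are 6, 4 and 30 times P^j
  B_j(s/P) for j = 2, 3, 4. The first and the last depend on \<open>s\<close> only through
  \<open>s * (P - s)\<close>, while \<open>w2\<close> changes sign under \<open>s\<close> to
  \<open>P - s\<close>. The denominator 30 is a unit modulo \<open>q\<close> from
  \<open>q \<ge> 7\<close> on.\<close>

lemma moment_relations:
  fixes P q c a b d e A B D E :: int
  assumes P: "P > 0" and q: "prime q" "q \<ge> 5" and c: "0 \<le> c" "c < P" "coprime c P"
    and co: "coprime a (P * q)" "coprime b (P * q)" "coprime d (P * q)" "coprime e (P * q)"
    and inv: "[a * A = 1] (mod q\<^sup>2)" "[b * B = 1] (mod q\<^sup>2)" "[d * D = 1] (mod q\<^sup>2)" "[e * E = 1] (mod q\<^sup>2)"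
    and sum: "P * q dvd a + b + d + e" and bal: "balanced (P * q) a b d e"
  defines "w1 \<equiv> \<lambda>s. P\<^sup>2 - 6 * (s * (P - s))"
    and "w2 \<equiv> \<lambda>s. s * (P - s) * (P - 2 * s)"
    and "w3 \<equiv> \<lambda>s. 30 * (s * (P - s))\<^sup>2 - P ^ 4"
  shows "q dvd A * w1 (c * a mod P) + B * w1 (c * b mod P) + D * w1 (c * d mod P) + E * w1 (c * e mod P)"
    and "q dvd A\<^sup>2 * w2 (c * a mod P) + B\<^sup>2 * w2 (c * b mod P)
           + D\<^sup>2 * w2 (c * d mod P) + E\<^sup>2 * w2 (c * e mod P)"
    and "q \<ge> 7 \<Longrightarrow> q dvd A ^ 3 * w3 (c * a mod P) + B ^ 3 * w3 (c * b mod P)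
           + D ^ 3 * w3 (c * d mod P) + E ^ 3 * w3 (c * e mod P)"
proof -
  have q0: "q \<ge> 0" using q by simp
  have co2: "coprime 2 q" and co3: "coprime 3 q" using q primes_coprime[of 2 q] primes_coprime[of 3 q] by auto
  have "coprime (2 * 3) q" "coprime (2 * 2) q" using co2 co3 by (simp_all only: coprime_mult_left_iff simp_thms)
  hence co6: "coprime 6 q" and co4: "coprime 4 q" by simp_all
  have dvdI: "q dvd x" if "N * x = q * y" "coprime N q" for N x y
  proof -
    have "q dvd N * x" using that(1) by simp
    thus ?thesis using that(2) by (metis coprime_commute coprime_dvd_mult_right_iff)
  qed
  have T1: "q dvd (\<Sum>t\<in>{0..<q}. (s + P * t) ^ 1)" for s
    using class_power_sums(1)[OF q0] co2 by (rule dvdI)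
  have T2: "q dvd (\<Sum>t\<in>{0..<q}. (s + P * t) ^ 2)" for s
    using class_power_sums(2)[OF q0] co6 by (rule dvdI)
  have T3: "q dvd (\<Sum>t\<in>{0..<q}. (s + P * t) ^ 3)" for s
    using class_power_sums(3)[OF q0] co4 by (rule dvdI)
  have W1: "[6 * (\<Sum>t\<in>{0..<q}. (s + P * t) ^ Suc 1) = q * w1 s] (mod q\<^sup>2)" for s
  proof -
    have "6 * (\<Sum>t\<in>{0..<q}. (s + P * t) ^ Suc 1) = q * w1 s + q\<^sup>2 * (6 * s * P + P\<^sup>2 * (2 * q - 3))"
      unfolding Suc_1 class_power_sums(2)[OF q0] w1_def
      by (simp add: algebra_simps power2_eq_square)
    thus ?thesis by (simp add: cong_def)
  qed
  have W2: "[4 * (\<Sum>t\<in>{0..<q}. (s + P * t) ^ Suc 2) = q * (2 * w2 s)] (mod q\<^sup>2)" for s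
  proof -
    have "Suc 2 = 3" by simp
    have "4 * (\<Sum>t\<in>{0..<q}. (s + P * t) ^ Suc 2)
       = q * (2 * w2 s) + q\<^sup>2 * (6 * s\<^sup>2 * P + 2 * s * P\<^sup>2 * (2 * q - 3) + P ^ 3 * (q - 1)\<^sup>2)"
      unfolding \<open>Suc 2 = 3\<close> class_power_sums(3)[OF q0] w2_def
      by (simp add: algebra_simps power2_eq_square power3_eq_cube)
    thus ?thesis by (simp add: cong_def)
  qed
  have W3: "[30 * (\<Sum>t\<in>{0..<q}. (s + P * t) ^ Suc 3) = q * w3 s] (mod q\<^sup>2)" for s
  proof -
    have "Suc 3 = 4" by simp
    have "30 * (\<Sum>t\<in>{0..<q}. (s + P * t) ^ Suc 3)
       = q * w3 s + q\<^sup>2 * (60 * s ^ 3 * P + 30 * s\<^sup>2 * P\<^sup>2 * (2 * q - 3) + 30 * s * P ^ 3 * (q - 1)\<^sup>2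
          + P ^ 4 * (6 * q ^ 3 - 15 * q\<^sup>2 + 10 * q))"
      unfolding \<open>Suc 3 = 4\<close> class_power_sums(4)[OF q0] w3_def
      by (simp add: algebra_simps eval_nat_numeral)
    thus ?thesis by (simp add: cong_def)
  qed
  note R = moment_relation[OF P q(1) c co inv sum bal]
  show "q dvd A * w1 (c * a mod P) + B * w1 (c * b mod P) + D * w1 (c * d mod P) + E * w1 (c * e mod P)"
    using R[OF _ co6 T1 W1] by simp
  have "q dvd A\<^sup>2 * (2 * w2 (c * a mod P)) + B\<^sup>2 * (2 * w2 (c * b mod P))
           + D\<^sup>2 * (2 * w2 (c * d mod P)) + E\<^sup>2 * (2 * w2 (c * e mod P))"
    by (rule R[OF _ co4 T2 W2]) simp
  hence "q dvd 2 * (A\<^sup>2 * w2 (c * a mod P) + B\<^sup>2 * w2 (c * b mod P)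
           + D\<^sup>2 * w2 (c * d mod P) + E\<^sup>2 * w2 (c * e mod P))"
    by (simp only: distrib_left mult.left_commute)
  thus "q dvd A\<^sup>2 * w2 (c * a mod P) + B\<^sup>2 * w2 (c * b mod P)
           + D\<^sup>2 * w2 (c * d mod P) + E\<^sup>2 * w2 (c * e mod P)"
    using co2 by (metis coprime_commute coprime_dvd_mult_right_iff)
  assume "q \<ge> 7"
  hence "coprime 5 q" using q primes_coprime[of 5 q] by auto
  hence "coprime (6 * 5) q" using co6 by (simp only: coprime_mult_left_iff simp_thms)
  hence co30: "coprime 30 q" by simp
  show "q dvd A ^ 3 * w3 (c * a mod P) + B ^ 3 * w3 (c * b mod P)
           + D ^ 3 * w3 (c * d mod P) + E ^ 3 * w3 (c * e mod P)"
    by (rule R[OF _ co30 T3 W3]) simp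
qed

section \<open>Prime modulus\<close>

text \<open>Vanishing sum and vanishing sum of inverses mean that the first and third elementary
  symmetric functions e1 and e3 vanish modulo \<open>q\<close>, and (a + b)(a + c)(b + c) = e1 (ab +
  bc + ca) - e3.\<close>

lemma pair_mod_prime:
  fixes q a b c d A B C D :: int
  assumes q: "prime q" and inv: "[a * A = 1] (mod q)" "[b * B = 1] (mod q)" "[c * C = 1] (mod q)" "[d * D = 1] (mod q)"
    and sum: "q dvd a + b + c + d" and isum: "q dvd A + B + C + D"
  shows "q dvd a + b \<or> q dvd a + c \<or> q dvd a + d"
proof -
  have "[b * c * d * (a * A) + a * c * d * (b * B) + a * b * d * (c * C) + a * b * c * (d * D)
     = b * c * d * 1 + a * c * d * 1 + a * b * d * 1 + a * b * c * 1] (mod q)"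
    by (intro cong_add cong_scalar_left inv)
  moreover have "b * c * d * (a * A) + a * c * d * (b * B) + a * b * d * (c * C) + a * b * c * (d * D)
     = a * b * c * d * (A + B + C + D)" by (simp add: algebra_simps)
  ultimately have "q dvd b * c * d * 1 + a * c * d * 1 + a * b * d * 1 + a * b * c * 1"
    using isum cong_dvd_iff dvd_mult by metis
  moreover have "b * c * d * 1 + a * c * d * 1 + a * b * d * 1 + a * b * c * 1
     = (a + b + c + d) * (a * b + b * c + c * a) - (a + b) * (a + c) * (b + c)"
    by (simp add: algebra_simps)
  ultimately have "q dvd (a + b) * (a + c) * (b + c)"
    using sum by (metis dvd_diff_right_iff dvd_mult2)
  hence "q dvd a + b \<or> q dvd a + c \<or> q dvd b + c" using q by (simp add: prime_dvd_mult_iff)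
  moreover have "q dvd a + d" if "q dvd b + c"
  proof -
    have "a + d = (a + b + c + d) - (b + c)" by simp
    thus ?thesis using that sum by (metis dvd_diff)
  qed
  ultimately show ?thesis by blast
qed

text \<open>For \<open>P = 1\<close> the only residue is 0 and \<open>w1\<close> equals 1 there, so
  the first moment relation says that the inverses add up to 0 modulo \<open>q\<close>.\<close>

lemma balanced_prime_pair:
  fixes q a b c d :: int
  assumes q: "prime q" "q \<ge> 5" and co: "coprime a q" "coprime b q" "coprime c q" "coprime d q"
    and sum: "q dvd a + b + c + d" and bal: "balanced q a b c d"
  shows "q dvd a + b \<or> q dvd a + c \<or> q dvd a + d"
proof -
  have "\<exists>X. [x * X = 1] (mod q\<^sup>2)" if "coprime x q" for x
    using that cong_solve_coprime_int by (simp add: coprime_power_right_iff)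
  then obtain A B C D where inv: "[a * A = 1] (mod q\<^sup>2)" "[b * B = 1] (mod q\<^sup>2)"
      "[c * C = 1] (mod q\<^sup>2)" "[d * D = 1] (mod q\<^sup>2)"
    using co by metis
  have "q dvd A + B + C + D"
    using moment_relations(1)[of 1 q 0 a b c d A B C D] q co inv sum bal by simp
  moreover have "[x = y] (mod q)" if "[x = y] (mod q\<^sup>2)" for x y
    using that by (rule cong_dvd_modulus) (simp add: power2_eq_square)
  ultimately show ?thesis using pair_mod_prime[OF q(1) _ _ _ _ sum] inv by blast
qed

section \<open>A product of two primes\<close>

text \<open>The difference factors as \<open>(s - t) * (p - (s + t))\<close>, and
  \<open>p < q\<close> makes both factors smaller than \<open>q\<close> in absolute value, so a
  factor divisible by \<open>q\<close> is 0.\<close>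

lemma residue_product_eq:
  fixes p q s t :: int
  assumes "prime q" "p < q" "0 < s" "s < p" "0 < t" "t < p" "q dvd s * (p - s) - t * (p - t)"
  shows "s = t \<or> s + t = p"
proof -
  have "s * (p - s) - t * (p - t) = (s - t) * (p - (s + t))" by (simp add: algebra_simps)
  hence "q dvd s - t \<or> q dvd p - (s + t)" using assms(1,7) by (simp add: prime_dvd_mult_iff)
  moreover have "\<bar>s - t\<bar> < q" "\<bar>p - (s + t)\<bar> < q" using assms(2-6) by linarith+
  ultimately have "s - t = 0 \<or> p - (s + t) = 0"
    by (metis abs_dvd_iff abs_of_nonneg abs_ge_zero dvd_abs_iff zdvd_not_zless zero_less_abs_iff)
  thus ?thesis by auto
qed

lemma sum_units_mod_prime:
  fixes p x :: int and f :: "int \<Rightarrow> int"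
  assumes "p > 0" "coprime x p"
  shows "(\<Sum>r\<in>{1..<p}. f (r * x mod p)) = (\<Sum>r\<in>{1..<p}. f r)"
proof -
  have ins: "{0..<p} = insert 0 {1..<p}" using assms by auto
  have "(\<Sum>r\<in>{0..<p}. f ((0 + r * x) mod p)) = (\<Sum>r\<in>{0..<p}. f r)"
    using bij_betw_affine_mod[OF assms] by (rule sum.reindex_bij_betw)
  thus ?thesis unfolding ins by simp
qed

lemma sum_residue_product:
  fixes p :: int
  assumes "p > 0"
  shows "6 * (\<Sum>r\<in>{1..<p}. r * (p - r)) = p * (p - 1) * (p + 1)"
proof -
  have ins: "{0..<p} = insert 0 {1..<p}" using assms by auto
  have "6 * (\<Sum>r\<in>{0..<p}. r * (p - r)) = 3 * p * (2 * (\<Sum>r\<in>{0..<p}. r)) - 6 * (\<Sum>r\<in>{0..<p}. r\<^sup>2)"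
    by (simp add: right_diff_distrib sum_subtractf power2_eq_square sum_distrib_left mult_ac)
  also have "\<dots> = 3 * p * (p * (p - 1)) - p * ((p - 1) * (2 * p - 1))"
    using class_power_sums(1)[of p 0 1] class_power_sums(2)[of p 0 1] assms by simp
  also have "\<dots> = p * (p - 1) * (p + 1)" by (simp add: algebra_simps)
  finally show ?thesis unfolding ins by simp
qed

text \<open>\<open>H1\<close>, \<open>H2\<close>, \<open>H3\<close> are the moment relations once
  the inverses of \<open>b\<close> and \<open>d\<close> are replaced by \<open>- A\<close> and
  \<open>- C\<close>. Either \<open>a\<close> and \<open>b\<close> agree up to sign modulo
  \<open>p\<close>, and then \<open>H1\<close> and \<open>H2\<close> suffice; or \<open>H3\<close>
  can be divided by \<open>H1\<close>, and summation over \<open>r\<close> shows that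
  \<open>A\<close> is \<open>C\<close> or \<open>- C\<close> modulo \<open>q\<close>. This gives a
  second cancelling pair modulo \<open>q\<close>, and the residues modulo \<open>p\<close> decide
  which pair cancels modulo both primes.\<close>

lemma two_prime_pair:
  fixes p q a b c d A C :: int
  defines "\<beta> \<equiv> \<lambda>r x. (r * x mod p) * (p - r * x mod p)"
  assumes p: "prime p" "p \<ge> 5" and q: "prime q" "p < q"
    and nd: "\<not> p dvd a" "\<not> p dvd b" "\<not> p dvd c" "\<not> p dvd d"
    and sum: "p dvd a + b + c + d" and qab: "q dvd a + b" and qcd: "q dvd c + d"
    and inv: "[a * A = 1] (mod q)" "[c * C = 1] (mod q)"
    and H1: "\<And>r. r \<in> {1..<p} \<Longrightarrow> q dvd A * (\<beta> r a - \<beta> r b) + C * (\<beta> r c - \<beta> r d)"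
    and H2: "q dvd A\<^sup>2 * (\<beta> 1 a * (p - 2 * (1 * a mod p)) + \<beta> 1 b * (p - 2 * (1 * b mod p)))
               + C\<^sup>2 * (\<beta> 1 c * (p - 2 * (1 * c mod p)) + \<beta> 1 d * (p - 2 * (1 * d mod p)))"
    and H3: "\<And>r. r \<in> {1..<p} \<Longrightarrow>
               q dvd A ^ 3 * ((\<beta> r a)\<^sup>2 - (\<beta> r b)\<^sup>2) + C ^ 3 * ((\<beta> r c)\<^sup>2 - (\<beta> r d)\<^sup>2)"
  shows "p * q dvd a + b \<or> p * q dvd a + c \<or> p * q dvd a + d"
proof -
  have p0: "p > 0" and q7: "q > 5" using p q by simp_all
  have odd: "odd p" "odd q" using prime_odd_int[OF p(1)] prime_odd_int[OF q(1)] p q by simp_all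
  have pq: "coprime p q" using p(1) q primes_coprime[of p q] by simp
  have join: "p * q dvd x" if "p dvd x" "q dvd x" for x using divides_mult[OF that pq] .
  have q2: "\<not> q dvd 2" using q7 zdvd_not_zless[of 2 q] by simp
  have p2: "\<not> p dvd 2" using p zdvd_not_zless[of 2 p] by simp
  have qA: "\<not> q dvd A"
  proof
    assume "q dvd A"
    hence "q dvd a * A" by simp
    hence "q dvd 1" using inv(1) cong_dvd_iff by blast
    thus False using q(1) not_prime_unit by blast
  qed
  have qC: "\<not> q dvd C"
  proof
    assume "q dvd C"
    hence "q dvd c * C" by simp
    hence "q dvd 1" using inv(2) cong_dvd_iff by blast
    thus False using q(1) not_prime_unit by blast
  qed
  have res: "0 < x mod p" "x mod p < p" if "\<not> p dvd x" for x
  proof -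
    have "x mod p \<noteq> 0" using that by (simp add: dvd_eq_mod_eq_0)
    thus "0 < x mod p" using pos_mod_sign[OF p0, of x] by linarith
    show "x mod p < p" by (rule pos_mod_bound[OF p0])
  qed
  define s where "s = (\<lambda>x. x mod p)"
  have s: "0 < s a" "s a < p" "0 < s b" "s b < p" "0 < s c" "s c < p" "0 < s d" "s d < p"
    using res nd by (simp_all add: s_def)
  have \<beta>1: "\<beta> 1 x = s x * (p - s x)" for x by (simp add: \<beta>_def s_def)
  have sdvd: "p dvd s x + s y \<longleftrightarrow> p dvd x + y" for x y
    unfolding s_def by (simp add: dvd_eq_mod_eq_0 mod_add_eq)
  have pairp: "p dvd x + y" if "s x + s y = p" for x y
    using that sdvd[of x y] by simp
  have s4: "p dvd s a + s b + s c + s d"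
  proof -
    have "[s a + s b + s c + s d = a + b + c + d] (mod p)"
      by (intro cong_add) (simp_all add: s_def cong_def)
    thus ?thesis using sum cong_dvd_iff by blast
  qed
  have pcomp: "p dvd x + y" if "p dvd z + w" "x + y + (z + w) = a + b + c + d" for x y z w
  proof -
    have "x + y = (a + b + c + d) - (z + w)" using that(2) by simp
    thus ?thesis using dvd_diff[OF sum that(1)] by simp
  qed
  have half: "p dvd x" if "p dvd 2 * x" for x using that p2 p(1) by (simp add: prime_dvd_mult_iff)
  have qhalf: "q dvd x" if "q dvd 2 * x" for x using that q2 q(1) by (simp add: prime_dvd_mult_iff)
  have acm: "[a * c * (A - C) = c - a] (mod q)"
  proof -
    have "[c * (a * A) - a * (c * C) = c * 1 - a * 1] (mod q)" by (intro cong_diff cong_scalar_left inv)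
    moreover have "c * (a * A) - a * (c * C) = a * c * (A - C)" by (simp add: algebra_simps)
    ultimately show ?thesis by simp
  qed
  have acp: "[a * c * (A + C) = c + a] (mod q)"
  proof -
    have "[c * (a * A) + a * (c * C) = c * 1 + a * 1] (mod q)" by (intro cong_add cong_scalar_left inv)
    moreover have "c * (a * A) + a * (c * C) = a * c * (A + C)" by (simp add: algebra_simps)
    ultimately show ?thesis by simp
  qed
  have qad: "q dvd a + d" if "q dvd A - C"
  proof -
    have "q dvd c - a" using acm that cong_dvd_iff dvd_mult by blast
    moreover have "a + d = (c + d) - (c - a)" by simp
    ultimately show ?thesis using qcd dvd_diff by metis
  qed
  have qac: "q dvd a + c" if "q dvd A + C"
    using acp that cong_dvd_iff dvd_mult add.commute by metis
  have one: "1 \<in> {1..<p}" using p by simp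
  show ?thesis
  proof (cases "q dvd \<beta> 1 a - \<beta> 1 b")
    case True
    hence "s a = s b \<or> s a + s b = p" using residue_product_eq[OF q] s unfolding \<beta>1 by blast
    moreover have ?thesis if "s a + s b = p" using join[OF pairp[OF that] qab] by blast
    moreover have ?thesis if ab: "s a = s b"
    proof -
      have "q dvd C * (\<beta> 1 c - \<beta> 1 d)" using H1[OF one] True by (simp add: dvd_add_right_iff)
      hence "q dvd \<beta> 1 c - \<beta> 1 d" using qC q(1) by (simp add: prime_dvd_mult_iff)
      hence "s c = s d \<or> s c + s d = p" using residue_product_eq[OF q] s unfolding \<beta>1 by blast
      moreover have ?thesis if "s c + s d = p"
        using join[OF pcomp[OF pairp[OF that]] qab] by (simp add: algebra_simps)
      moreover have ?thesis if cd: "s c = s d"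
      proof -
        have "p dvd 2 * (s a + s c)" using s4 ab cd by (simp add: algebra_simps)
        hence "p dvd s a + s c" by (rule half)
        then obtain t where t: "s a + s c = p * t" by blast
        have "0 < p * t" "p * t < p * 2" using t s by linarith+
        hence "t = 1" using p0 by (auto simp: zero_less_mult_iff)
        hence ac: "s a + s c = p" using t by simp
        \<comment> \<open>Now \<open>b\<close> has the residue of \<open>a\<close>, and
          \<open>c\<close>, \<open>d\<close> have its negative. The odd relation \<open>H2\<close>
          becomes 2 g (A^2 - C^2), where \<open>g\<close> is prime to \<open>q\<close> since
          \<open>p\<close> is odd and smaller than \<open>q\<close>.\<close>
        define g where "g = s a * (p - s a) * (p - 2 * s a)"
        have sc: "s c = p - s a" "s d = p - s a" "s b = s a" using ac cd ab by simp_all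
        have "A\<^sup>2 * (\<beta> 1 a * (p - 2 * (a mod p)) + \<beta> 1 b * (p - 2 * (b mod p)))
            + C\<^sup>2 * (\<beta> 1 c * (p - 2 * (c mod p)) + \<beta> 1 d * (p - 2 * (d mod p)))
            = 2 * (g * ((A - C) * (A + C)))"
          unfolding \<beta>1 s_def[THEN fun_cong, symmetric] sc g_def
          by (simp add: algebra_simps power2_eq_square)
        hence "q dvd 2 * (g * ((A - C) * (A + C)))" using H2[unfolded mult_1] by simp
        hence "q dvd g * ((A - C) * (A + C))" by (rule qhalf)
        moreover have "\<not> q dvd g"
        proof -
          have "\<not> q dvd s a" "\<not> q dvd p - s a" using s(1,2) q(2) zdvd_not_zless by auto
          moreover have "\<not> q dvd p - 2 * s a"
          proof
            assume "q dvd p - 2 * s a"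
            moreover have "\<bar>p - 2 * s a\<bar> < q" using s(1,2) q(2) by linarith
            ultimately have "p - 2 * s a = 0"
              by (metis abs_dvd_iff abs_of_nonneg abs_ge_zero dvd_abs_iff zdvd_not_zless zero_less_abs_iff)
            hence "2 dvd p" by presburger
            thus False using odd by simp
          qed
          ultimately show ?thesis using q(1) by (simp add: g_def prime_dvd_mult_iff)
        qed
        ultimately have "q dvd A - C \<or> q dvd A + C" using q(1) by (simp add: prime_dvd_mult_iff)
        moreover have "p dvd a + d" using pairp[of a d] ac cd by simp
        moreover have "p dvd a + c" using pairp ac by simp
        ultimately show ?thesis using join qad qac by blast
      qed
      ultimately show ?thesis by blast
    qed
    ultimately show ?thesis by blast
  next
    case False
    \<comment> \<open>Agreement at a single \<open>r\<close> would make \<open>a\<close> equal to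
      \<open>b\<close> or \<open>- b\<close> modulo \<open>p\<close>, a condition independent of
      \<open>r\<close>, and hence give agreement at 1.\<close>
    have nD: "\<not> q dvd \<beta> r a - \<beta> r b" if r: "r \<in> {1..<p}" for r
    proof
      assume D: "q dvd \<beta> r a - \<beta> r b"
      have "\<not> p dvd r" using r zdvd_not_zless by auto
      hence "\<not> p dvd r * a" "\<not> p dvd r * b" using nd p(1) by (simp_all add: prime_dvd_mult_iff)
      hence "0 < r * a mod p" "r * a mod p < p" "0 < r * b mod p" "r * b mod p < p" using res by blast+
      hence "r * a mod p = r * b mod p \<or> r * a mod p + r * b mod p = p"
        using residue_product_eq[OF q] D unfolding \<beta>_def by blast
      hence "s a = s b \<or> p dvd s a + s b"
      proof
        assume "r * a mod p = r * b mod p"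
        hence "p dvd r * (a - b)" by (simp add: mod_eq_dvd_iff right_diff_distrib)
        hence "p dvd a - b" using \<open>\<not> p dvd r\<close> p(1) by (simp add: prime_dvd_mult_iff)
        thus ?thesis by (simp add: s_def mod_eq_dvd_iff)
      next
        assume "r * a mod p + r * b mod p = p"
        hence "p dvd r * a mod p + r * b mod p" by simp
        hence "p dvd r * (a + b)" by (simp add: dvd_eq_mod_eq_0 mod_add_eq distrib_left)
        hence "p dvd a + b" using \<open>\<not> p dvd r\<close> p(1) by (simp add: prime_dvd_mult_iff)
        thus ?thesis using sdvd by blast
      qed
      moreover have "s a + s b = p" if dv: "p dvd s a + s b"
      proof -
        from dv obtain t where t: "s a + s b = p * t" by blast
        have "0 < p * t" "p * t < p * 2" using t s by linarith+
        hence "t = 1" using p0 by (auto simp: zero_less_mult_iff)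
        thus ?thesis using t by simp
      qed
      ultimately have "s a = s b \<or> s b = p - s a" by linarith
      hence "\<beta> 1 a = \<beta> 1 b" unfolding \<beta>1 by auto
      thus False using False by simp
    qed
    \<comment> \<open>The differences of squares in \<open>H3\<close> contain the differences in
      \<open>H1\<close>. Eliminating \<open>C * (\<beta> r c - \<beta> r d)\<close> leaves the claim
      times \<open>A * (\<beta> r a - \<beta> r b)\<close>, which is prime to
      \<open>q\<close>.\<close>
    have key: "q dvd A\<^sup>2 * (\<beta> r a + \<beta> r b) - C\<^sup>2 * (\<beta> r c + \<beta> r d)" if r: "r \<in> {1..<p}" for r
    proof -
      have "A * (\<beta> r a - \<beta> r b) * (A\<^sup>2 * (\<beta> r a + \<beta> r b) - C\<^sup>2 * (\<beta> r c + \<beta> r d))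
        = (A ^ 3 * ((\<beta> r a)\<^sup>2 - (\<beta> r b)\<^sup>2) + C ^ 3 * ((\<beta> r c)\<^sup>2 - (\<beta> r d)\<^sup>2))
          - C\<^sup>2 * (\<beta> r c + \<beta> r d) * (A * (\<beta> r a - \<beta> r b) + C * (\<beta> r c - \<beta> r d))"
        by (simp add: algebra_simps power2_eq_square power3_eq_cube)
      hence "q dvd A * (\<beta> r a - \<beta> r b) * (A\<^sup>2 * (\<beta> r a + \<beta> r b) - C\<^sup>2 * (\<beta> r c + \<beta> r d))"
        using dvd_diff[OF H3[OF r] dvd_mult[OF H1[OF r]]] by simp
      thus ?thesis using q(1) qA nD[OF r] by (simp add: prime_dvd_mult_iff)
    qed
    define K where "K = (\<Sum>r\<in>{1..<p}. r * (p - r))"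
    have sum\<beta>: "(\<Sum>r\<in>{1..<p}. \<beta> r x) = K" if "\<not> p dvd x" for x
    proof -
      have "coprime x p" using that p(1) prime_imp_coprime coprime_commute by blast
      thus ?thesis unfolding \<beta>_def K_def
        using sum_units_mod_prime[OF p0, of x "\<lambda>s. s * (p - s)"] by simp
    qed
    \<comment> \<open>Summed over \<open>r\<close>, every \<open>\<beta> r x\<close> gives the same
      \<open>K\<close>, so 2 K (A^2 - C^2) remains. The factor 3 below produces
      \<open>6 * K = p * (p - 1) * (p + 1)\<close>, prime to \<open>q\<close> since
      \<open>q > p\<close> and, by parity, \<open>q\<close> is not \<open>p + 1\<close>.\<close>
    have "q dvd (\<Sum>r\<in>{1..<p}. A\<^sup>2 * (\<beta> r a + \<beta> r b) - C\<^sup>2 * (\<beta> r c + \<beta> r d))"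
      by (rule dvd_sum) (rule key)
    also have "(\<Sum>r\<in>{1..<p}. A\<^sup>2 * (\<beta> r a + \<beta> r b) - C\<^sup>2 * (\<beta> r c + \<beta> r d)) = A\<^sup>2 * (K + K) - C\<^sup>2 * (K + K)"
      unfolding sum_subtractf sum_distrib_left[symmetric] sum.distrib
        sum\<beta>[OF nd(1)] sum\<beta>[OF nd(2)] sum\<beta>[OF nd(3)] sum\<beta>[OF nd(4)] ..
    finally have "q dvd 3 * (A\<^sup>2 * (K + K) - C\<^sup>2 * (K + K))" by (rule dvd_mult)
    also have "3 * (A\<^sup>2 * (K + K) - C\<^sup>2 * (K + K)) = (A - C) * (A + C) * (6 * K)"
      by (simp add: algebra_simps power2_eq_square)
    also have "6 * K = p * (p - 1) * (p + 1)" unfolding K_def by (rule sum_residue_product[OF p0])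
    finally have "q dvd (A - C) * (A + C) * (p * (p - 1) * (p + 1))" .
    moreover have "\<not> q dvd p" "\<not> q dvd p - 1" using p q zdvd_not_zless by auto
    moreover have "\<not> q dvd p + 1"
    proof
      assume "q dvd p + 1"
      hence "q = p + 1" using q(2) p0 zdvd_imp_le[of q "p + 1"] by simp
      thus False using odd by simp
    qed
    ultimately have "q dvd A - C \<or> q dvd A + C" using q(1) by (simp add: prime_dvd_mult_iff)
    thus ?thesis
    proof
      assume AC: "q dvd A - C"
      \<comment> \<open>With \<open>C\<close> replaced by \<open>A\<close>, the sum and the
        difference of \<open>H1\<close> and \<open>key\<close> at 1 match \<open>a\<close> with
        \<open>d\<close> and \<open>b\<close> with \<open>c\<close>, up to sign modulo
        \<open>p\<close>. The case \<open>q dvd A + C\<close> is the same with \<open>c\<close> and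
        \<open>d\<close> exchanged.\<close>
      have "A * (\<beta> 1 a - \<beta> 1 b + \<beta> 1 c - \<beta> 1 d) = (A * (\<beta> 1 a - \<beta> 1 b) + C * (\<beta> 1 c - \<beta> 1 d))
          + (A - C) * (\<beta> 1 c - \<beta> 1 d)" by (simp add: algebra_simps)
      hence "q dvd A * (\<beta> 1 a - \<beta> 1 b + \<beta> 1 c - \<beta> 1 d)"
        using dvd_add[OF H1[OF one] dvd_mult2[OF AC]] by simp
      hence 1: "q dvd \<beta> 1 a - \<beta> 1 b + \<beta> 1 c - \<beta> 1 d" using qA q(1) by (simp add: prime_dvd_mult_iff)
      have "A\<^sup>2 * (\<beta> 1 a + \<beta> 1 b - \<beta> 1 c - \<beta> 1 d) = (A\<^sup>2 * (\<beta> 1 a + \<beta> 1 b) - C\<^sup>2 * (\<beta> 1 c + \<beta> 1 d))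
          - (A - C) * ((A + C) * (\<beta> 1 c + \<beta> 1 d))" by (simp add: algebra_simps power2_eq_square)
      hence "q dvd A\<^sup>2 * (\<beta> 1 a + \<beta> 1 b - \<beta> 1 c - \<beta> 1 d)"
        using dvd_diff[OF key[OF one] dvd_mult2[OF AC]] by simp
      hence 2: "q dvd \<beta> 1 a + \<beta> 1 b - \<beta> 1 c - \<beta> 1 d"
        using qA q(1) by (simp add: prime_dvd_mult_iff prime_dvd_power_iff)
      have "q dvd 2 * (\<beta> 1 a - \<beta> 1 d)" using dvd_add[OF 1 2] by (simp add: algebra_simps)
      hence "q dvd \<beta> 1 a - \<beta> 1 d" by (rule qhalf)
      hence ad: "s a = s d \<or> s a + s d = p" using residue_product_eq[OF q] s unfolding \<beta>1 by blast
      have "q dvd 2 * (\<beta> 1 b - \<beta> 1 c)" using dvd_diff[OF 2 1] by (simp add: algebra_simps)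
      hence "q dvd \<beta> 1 b - \<beta> 1 c" by (rule qhalf)
      hence bc: "s b = s c \<or> s b + s c = p" using residue_product_eq[OF q] s unfolding \<beta>1 by blast
      \<comment> \<open>If neither matched pair adds up to \<open>p\<close>, both consist of equal
        residues, and the total is twice \<open>s a + s b\<close>.\<close>
      have "p dvd a + d \<or> p dvd a + b"
      proof (cases "s a + s d = p \<or> s b + s c = p")
        case True
        thus ?thesis
        proof
          assume "s b + s c = p"
          from pcomp[OF pairp[OF this], of a d] show ?thesis by simp
        qed (use pairp in blast)
      next
        case False
        hence "p dvd 2 * (s a + s b)" using ad bc s4 by (simp add: algebra_simps)
        thus ?thesis using half sdvd by blast
      qed
      thus ?thesis using join qab qad[OF AC] by blast
    next
      assume AC: "q dvd A + C"
      have "A * (\<beta> 1 a - \<beta> 1 b - \<beta> 1 c + \<beta> 1 d) = (A * (\<beta> 1 a - \<beta> 1 b) + C * (\<beta> 1 c - \<beta> 1 d))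
          - (A + C) * (\<beta> 1 c - \<beta> 1 d)" by (simp add: algebra_simps)
      hence "q dvd A * (\<beta> 1 a - \<beta> 1 b - \<beta> 1 c + \<beta> 1 d)"
        using dvd_diff[OF H1[OF one] dvd_mult2[OF AC]] by simp
      hence 1: "q dvd \<beta> 1 a - \<beta> 1 b - \<beta> 1 c + \<beta> 1 d" using qA q(1) by (simp add: prime_dvd_mult_iff)
      have "A\<^sup>2 * (\<beta> 1 a + \<beta> 1 b - \<beta> 1 c - \<beta> 1 d) = (A\<^sup>2 * (\<beta> 1 a + \<beta> 1 b) - C\<^sup>2 * (\<beta> 1 c + \<beta> 1 d))
          - (A + C) * ((A - C) * (\<beta> 1 c + \<beta> 1 d))" by (simp add: algebra_simps power2_eq_square)
      hence "q dvd A\<^sup>2 * (\<beta> 1 a + \<beta> 1 b - \<beta> 1 c - \<beta> 1 d)"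
        using dvd_diff[OF key[OF one] dvd_mult2[OF AC]] by simp
      hence 2: "q dvd \<beta> 1 a + \<beta> 1 b - \<beta> 1 c - \<beta> 1 d"
        using qA q(1) by (simp add: prime_dvd_mult_iff prime_dvd_power_iff)
      have "q dvd 2 * (\<beta> 1 a - \<beta> 1 c)" using dvd_add[OF 1 2] by (simp add: algebra_simps)
      hence "q dvd \<beta> 1 a - \<beta> 1 c" by (rule qhalf)
      hence ac: "s a = s c \<or> s a + s c = p" using residue_product_eq[OF q] s unfolding \<beta>1 by blast
      have "q dvd 2 * (\<beta> 1 b - \<beta> 1 d)" using dvd_diff[OF 2 1] by (simp add: algebra_simps)
      hence "q dvd \<beta> 1 b - \<beta> 1 d" by (rule qhalf)
      hence bd: "s b = s d \<or> s b + s d = p" using residue_product_eq[OF q] s unfolding \<beta>1 by blast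
      have "p dvd a + c \<or> p dvd a + b"
      proof (cases "s a + s c = p \<or> s b + s d = p")
        case True
        thus ?thesis
        proof
          assume "s b + s d = p"
          from pcomp[OF pairp[OF this], of a c] show ?thesis by simp
        qed (use pairp in blast)
      next
        case False
        hence "p dvd 2 * (s a + s b)" using ac bd s4 by (simp add: algebra_simps)
        thus ?thesis using half sdvd by blast
      qed
      thus ?thesis using join qab qac[OF AC] by blast
    qed
  qed
qed

text \<open>Since \<open>q\<close> divides \<open>a + b\<close> and \<open>c + d\<close>, it divides
  \<open>A + B\<close> and \<open>C + D\<close>. Subtracting multiples of these from the moment
  relations eliminates \<open>B\<close> and \<open>D\<close>, cancels the constant terms of
  \<open>w1\<close> and \<open>w3\<close>, and leaves the hypotheses of
  \<open>two_prime_pair\<close>.\<close>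

lemma balanced_two_primes_pair_aux:
  fixes p q a b c d :: int
  assumes p: "prime p" "p \<ge> 5" and q: "prime q" "p < q"
    and co: "coprime a (p * q)" "coprime b (p * q)" "coprime c (p * q)" "coprime d (p * q)"
    and sum: "p * q dvd a + b + c + d" and bal: "balanced (p * q) a b c d"
    and qab: "q dvd a + b"
  shows "p * q dvd a + b \<or> p * q dvd a + c \<or> p * q dvd a + d"
proof -
  have p0: "p > 0" and q5: "q \<ge> 5" and q6: "q \<noteq> 6" using p q by (auto simp: prime_int_numeral_eq)
  have q7: "q \<ge> 7" using q(2) p(2) q6 by simp
  have "\<exists>X. [x * X = 1] (mod q\<^sup>2)" if "coprime x (p * q)" for x
    using that cong_solve_coprime_int by (simp add: coprime_power_right_iff)
  then obtain A B C D where inv: "[a * A = 1] (mod q\<^sup>2)" "[b * B = 1] (mod q\<^sup>2)"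
      "[c * C = 1] (mod q\<^sup>2)" "[d * D = 1] (mod q\<^sup>2)"
    using co by metis
  have modq: "[x = y] (mod q)" if "[x = y] (mod q\<^sup>2)" for x y
    using that by (rule cong_dvd_modulus) (simp add: power2_eq_square)
  have qcd: "q dvd c + d"
  proof -
    have "q dvd a + b + c + d" using sum dvd_mult_right by blast
    moreover have "c + d = (a + b + c + d) - (a + b)" by simp
    ultimately show ?thesis using qab dvd_diff by metis
  qed
  have opp: "q dvd X + Y" if xy: "q dvd x + y" "[x * X = 1] (mod q)" "[y * Y = 1] (mod q)" for x y X Y
  proof -
    have "[Y * (x * X) + X * (y * Y) = Y * 1 + X * 1] (mod q)" by (intro cong_add cong_scalar_left xy)
    moreover have "Y * (x * X) + X * (y * Y) = X * Y * (x + y)" by (simp add: algebra_simps)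
    ultimately have "[X * Y * (x + y) = X + Y] (mod q)" by (simp add: add.commute)
    thus ?thesis using xy(1) cong_dvd_iff dvd_mult by blast
  qed
  have AB: "q dvd A + B" using opp[OF qab] modq inv by blast
  have CD: "q dvd C + D" using opp[OF qcd] modq inv by blast
  have cop: "coprime r p" if "r \<in> {1..<p}" for r
  proof -
    have "\<not> p dvd r" using that zdvd_not_zless by auto
    thus ?thesis using p(1) prime_imp_coprime coprime_commute by blast
  qed
  have nd: "\<not> p dvd x" if "coprime x (p * q)" for x
    using that p(1) coprime_common_divisor[of x "p * q" p] not_prime_unit by auto
  define \<beta> where "\<beta> = (\<lambda>r x. (r * x mod p) * (p - r * x mod p))"
  have q6': "q dvd x" if "q dvd 6 * x" for x
  proof -
    have "\<not> q dvd 6" using q7 zdvd_not_zless[of 6 q] by simp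
    thus ?thesis using that q(1) by (simp add: prime_dvd_mult_iff)
  qed
  have q30: "q dvd x" if "q dvd 30 * x" for x
  proof -
    have "\<not> q dvd 5" using q7 zdvd_not_zless[of 5 q] by simp
    moreover have "q dvd 6 * (5 * x)" using that by simp
    hence "q dvd 5 * x" by (rule q6')
    ultimately show ?thesis using q(1) by (simp only: prime_dvd_mult_iff simp_thms)
  qed
  have R: "q dvd A * (\<beta> r a - \<beta> r b) + C * (\<beta> r c - \<beta> r d)"
    "q dvd A\<^sup>2 * (\<beta> r a * (p - 2 * (r * a mod p)) + \<beta> r b * (p - 2 * (r * b mod p)))
               + C\<^sup>2 * (\<beta> r c * (p - 2 * (r * c mod p)) + \<beta> r d * (p - 2 * (r * d mod p)))"
    "q dvd A ^ 3 * ((\<beta> r a)\<^sup>2 - (\<beta> r b)\<^sup>2) + C ^ 3 * ((\<beta> r c)\<^sup>2 - (\<beta> r d)\<^sup>2)"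
    if r: "r \<in> {1..<p}" for r
  proof -
    note M = moment_relations[OF p0 q(1) q5 _ _ cop[OF r] co inv sum bal]
    have r0: "0 \<le> r" "r < p" using r by auto
    let ?R1 = "A * (p\<^sup>2 - 6 * \<beta> r a) + B * (p\<^sup>2 - 6 * \<beta> r b) + C * (p\<^sup>2 - 6 * \<beta> r c) + D * (p\<^sup>2 - 6 * \<beta> r d)"
    have R1: "q dvd ?R1" using M(1)[OF r0] unfolding \<beta>_def .
    have "6 * (A * (\<beta> r a - \<beta> r b) + C * (\<beta> r c - \<beta> r d))
       = (A + B) * (p\<^sup>2 - 6 * \<beta> r b) + (C + D) * (p\<^sup>2 - 6 * \<beta> r d) - ?R1"
      by (simp add: algebra_simps)
    moreover have "q dvd (A + B) * (p\<^sup>2 - 6 * \<beta> r b) + (C + D) * (p\<^sup>2 - 6 * \<beta> r d) - ?R1"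
      by (intro dvd_diff dvd_add dvd_mult2 AB CD R1)
    ultimately have "q dvd 6 * (A * (\<beta> r a - \<beta> r b) + C * (\<beta> r c - \<beta> r d))" by (simp only:)
    thus "q dvd A * (\<beta> r a - \<beta> r b) + C * (\<beta> r c - \<beta> r d)" by (rule q6')
    define ga where "ga = \<beta> r a * (p - 2 * (r * a mod p))"
    define gb where "gb = \<beta> r b * (p - 2 * (r * b mod p))"
    define gc where "gc = \<beta> r c * (p - 2 * (r * c mod p))"
    define gd where "gd = \<beta> r d * (p - 2 * (r * d mod p))"
    have R2: "q dvd A\<^sup>2 * ga + B\<^sup>2 * gb + C\<^sup>2 * gc + D\<^sup>2 * gd"
      using M(2)[OF r0] unfolding \<beta>_def ga_def gb_def gc_def gd_def .
    have "A\<^sup>2 * (ga + gb) + C\<^sup>2 * (gc + gd) = (A\<^sup>2 * ga + B\<^sup>2 * gb + C\<^sup>2 * gc + D\<^sup>2 * gd)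
        - ((A + B) * ((B - A) * gb) + (C + D) * ((D - C) * gd))"
      by (simp add: algebra_simps power2_eq_square)
    moreover have "q dvd (A\<^sup>2 * ga + B\<^sup>2 * gb + C\<^sup>2 * gc + D\<^sup>2 * gd)
        - ((A + B) * ((B - A) * gb) + (C + D) * ((D - C) * gd))"
      by (intro dvd_diff[OF R2] dvd_add dvd_mult2 AB CD)
    ultimately show "q dvd A\<^sup>2 * (\<beta> r a * (p - 2 * (r * a mod p)) + \<beta> r b * (p - 2 * (r * b mod p)))
               + C\<^sup>2 * (\<beta> r c * (p - 2 * (r * c mod p)) + \<beta> r d * (p - 2 * (r * d mod p)))"
      by (simp only: ga_def gb_def gc_def gd_def)
    let ?R3 = "A ^ 3 * (30 * (\<beta> r a)\<^sup>2 - p ^ 4) + B ^ 3 * (30 * (\<beta> r b)\<^sup>2 - p ^ 4)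
        + C ^ 3 * (30 * (\<beta> r c)\<^sup>2 - p ^ 4) + D ^ 3 * (30 * (\<beta> r d)\<^sup>2 - p ^ 4)"
    have R3: "q dvd ?R3" using M(3)[OF r0 q7] unfolding \<beta>_def .
    have "30 * (A ^ 3 * ((\<beta> r a)\<^sup>2 - (\<beta> r b)\<^sup>2) + C ^ 3 * ((\<beta> r c)\<^sup>2 - (\<beta> r d)\<^sup>2))
      = ?R3 - ((A + B) * ((A\<^sup>2 - A * B + B\<^sup>2) * (30 * (\<beta> r b)\<^sup>2 - p ^ 4))
          + (C + D) * ((C\<^sup>2 - C * D + D\<^sup>2) * (30 * (\<beta> r d)\<^sup>2 - p ^ 4)))"
      by (simp add: algebra_simps power2_eq_square power3_eq_cube)
    moreover have "q dvd ?R3 - ((A + B) * ((A\<^sup>2 - A * B + B\<^sup>2) * (30 * (\<beta> r b)\<^sup>2 - p ^ 4))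
          + (C + D) * ((C\<^sup>2 - C * D + D\<^sup>2) * (30 * (\<beta> r d)\<^sup>2 - p ^ 4)))"
      by (intro dvd_diff[OF R3] dvd_add dvd_mult2 AB CD)
    ultimately have "q dvd 30 * (A ^ 3 * ((\<beta> r a)\<^sup>2 - (\<beta> r b)\<^sup>2) + C ^ 3 * ((\<beta> r c)\<^sup>2 - (\<beta> r d)\<^sup>2))"
      by (simp only:)
    thus "q dvd A ^ 3 * ((\<beta> r a)\<^sup>2 - (\<beta> r b)\<^sup>2) + C ^ 3 * ((\<beta> r c)\<^sup>2 - (\<beta> r d)\<^sup>2)" by (rule q30)
  qed
  have one: "1 \<in> {1..<p}" using p by simp
  have psum: "p dvd a + b + c + d" using sum dvd_mult_left by blast
  show ?thesis
    by (rule two_prime_pair[OF p q nd[OF co(1)] nd[OF co(2)] nd[OF co(3)] nd[OF co(4)] psum qab qcd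
          modq[OF inv(1)] modq[OF inv(3)] R(1)[unfolded \<beta>_def] R(2)[OF one, unfolded \<beta>_def]
          R(3)[unfolded \<beta>_def]])
qed

text \<open>Summing the first moment relation over all classes modulo \<open>p\<close> turns each
  weight into the same \<open>K = - p * (p - 1)\<close>, which is prime to \<open>q\<close>. So the
  inverses add up to 0 modulo \<open>q\<close> and a pair cancels modulo \<open>q\<close>; renaming
  makes it \<open>a\<close>, \<open>b\<close>.\<close>

lemma balanced_two_primes_pair:
  fixes p q a b c d :: int
  assumes p: "prime p" "p \<ge> 5" and q: "prime q" "p < q"
    and co: "coprime a (p * q)" "coprime b (p * q)" "coprime c (p * q)" "coprime d (p * q)"
    and sum: "p * q dvd a + b + c + d" and bal: "balanced (p * q) a b c d"
  shows "p * q dvd a + b \<or> p * q dvd a + c \<or> p * q dvd a + d"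
proof -
  have p0: "p > 0" and q5: "q \<ge> 5" using p q by auto
  have "\<exists>X. [x * X = 1] (mod q\<^sup>2)" if "coprime x (p * q)" for x
    using that cong_solve_coprime_int by (simp add: coprime_power_right_iff)
  then obtain A B C D where inv: "[a * A = 1] (mod q\<^sup>2)" "[b * B = 1] (mod q\<^sup>2)"
      "[c * C = 1] (mod q\<^sup>2)" "[d * D = 1] (mod q\<^sup>2)"
    using co by metis
  have modq: "[x = y] (mod q)" if "[x = y] (mod q\<^sup>2)" for x y
    using that by (rule cong_dvd_modulus) (simp add: power2_eq_square)
  define w where "w = (\<lambda>s. p\<^sup>2 - 6 * (s * (p - s)))"
  define K where "K = (\<Sum>r\<in>{1..<p}. w r)"
  have "q dvd (\<Sum>r\<in>{1..<p}. A * w (r * a mod p) + B * w (r * b mod p) + C * w (r * c mod p) + D * w (r * d mod p))"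
  proof (rule dvd_sum)
    fix r assume r: "r \<in> {1..<p}"
    hence "\<not> p dvd r" using zdvd_not_zless by auto
    hence "coprime r p" using p(1) prime_imp_coprime coprime_commute by blast
    moreover have "0 \<le> r" "r < p" using r by auto
    ultimately show "q dvd A * w (r * a mod p) + B * w (r * b mod p) + C * w (r * c mod p) + D * w (r * d mod p)"
      using moment_relations(1)[OF p0 q(1) q5 _ _ _ co inv sum bal] unfolding w_def by blast
  qed
  also have "(\<Sum>r\<in>{1..<p}. A * w (r * a mod p) + B * w (r * b mod p) + C * w (r * c mod p) + D * w (r * d mod p))
      = A * K + B * K + C * K + D * K"
  proof -
    have "(\<Sum>r\<in>{1..<p}. w (r * x mod p)) = K" if "coprime x (p * q)" for x
      unfolding K_def using that by (intro sum_units_mod_prime[OF p0]) simp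
    thus ?thesis unfolding sum.distrib sum_distrib_left[symmetric] using co by simp
  qed
  also have "\<dots> = (A + B + C + D) * K" by (simp add: algebra_simps)
  also have "K = - (p * (p - 1))"
  proof -
    have "K = (p - 1) * p\<^sup>2 - 6 * (\<Sum>r\<in>{1..<p}. r * (p - r))"
      unfolding K_def w_def sum_subtractf sum_distrib_left using p0 by simp
    thus ?thesis unfolding sum_residue_product[OF p0] by (simp add: algebra_simps power2_eq_square)
  qed
  finally have "q dvd (A + B + C + D) * - (p * (p - 1))" .
  moreover have "\<not> q dvd p" "\<not> q dvd p - 1" using p q zdvd_not_zless by auto
  ultimately have "q dvd A + B + C + D" using q(1) by (simp add: prime_dvd_mult_iff)
  moreover have "q dvd a + b + c + d" using sum dvd_mult_right by blast
  ultimately have "q dvd a + b \<or> q dvd a + c \<or> q dvd a + d"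
    using pair_mod_prime[OF q(1)] modq inv by blast
  moreover have "p * q dvd a + c + b + d" "p * q dvd a + d + c + b" using sum by (simp_all add: algebra_simps)
  moreover have "balanced (p * q) a c b d" "balanced (p * q) a d c b"
    using bal by (simp_all add: balanced_def algebra_simps)
  ultimately show ?thesis
    using balanced_two_primes_pair_aux[OF p q co(1) _ _ _ _ _] co sum bal by meson
qed

section \<open>Balanced quadruples contain a cancelling pair\<close>

text \<open>Induction removes a prime whose square divides \<open>n\<close>: balance descends to
  \<open>n / r\<close>, and the pair found there is lifted. What remains is 1, a prime, or a product
  of two primes. Only the set of possible prime divisors is recorded, a condition that passes to
  divisors of \<open>n\<close>.\<close>

lemma balanced_units_pair:
  fixes p q n a b c d :: int
  assumes "n > 0" "coprime n 6" and "\<And>r. prime r \<Longrightarrow> r dvd n \<Longrightarrow> r = p \<or> r = q"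
    and "coprime a n" "coprime b n" "coprime c n" "coprime d n"
    and "n dvd a + b + c + d" and "balanced n a b c d"
  shows "n dvd a + b \<or> n dvd a + c \<or> n dvd a + d"
  using assms
proof (induction "nat n" arbitrary: n rule: less_induct)
  case less
  note n = less.prems(1,2) and pq = less.prems(3) and co = less.prems(4-7)
    and sum = less.prems(8) and bal = less.prems(9)
  show ?case
  proof (cases "\<exists>r. prime r \<and> r * r dvd n")
    case True
    then obtain r l where r: "prime r" "n = r * r * l" by blast
    define k where "k = r * l"
    have nk: "n = r * k" and rk: "r dvd k" using r(2) by (simp_all add: k_def)
    have r1: "r > 1" using r(1) by (simp add: prime_gt_1_int)
    have k0: "k > 0" using n(1) nk r1 by (simp add: zero_less_mult_iff)
    have kn: "k dvd n" using nk by simp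
    have "nat k < nat n" using k0 r1 nk by simp
    moreover have "coprime k 6" using n(2) nk by simp
    moreover have "s = p \<or> s = q" if "prime s" "s dvd k" for s using pq that kn dvd_trans by blast
    moreover have "coprime x k" "coprime x r" if "coprime x n" for x using that nk by simp_all
    moreover from this have co_r: "coprime a r" "coprime b r" "coprime c r" "coprime d r" using co by blast+
    moreover have "k dvd a + b + c + d" using sum kn dvd_trans by blast
    moreover have "balanced k a b c d"
      using balanced_div_prime[OF r(1) rk k0 co_r] bal nk by simp
    ultimately have "k dvd a + b \<or> k dvd a + c \<or> k dvd a + d"
      using less.hyps[of k] k0 co by blast
    moreover have rk6: "coprime (r * k) 6" using n(2) nk by simp
    note L = balanced_pair_lift[OF rk6 r(1) rk k0 co_r(1)]
    have "n dvd a + c + b + d" "n dvd a + d + c + b" using sum by (simp_all add: algebra_simps)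
    moreover have "balanced n a c b d" "balanced n a d c b"
      using bal by (simp_all add: balanced_def algebra_simps)
    ultimately show ?thesis
      using L[of b c d] L[of c b d] L[of d c b] co_r sum bal unfolding nk by blast
  next
    case False
    show ?thesis
    proof (cases "n = 1")
      case True
      thus ?thesis by simp
    next
      case n1: False
      hence "\<not> is_unit n" using n(1) by auto
      then obtain r where r: "prime r" "r dvd n" using prime_divisor_exists n(1) by (metis less_irrefl)
      then obtain k where k: "n = r * k" by blast
      have r1: "r > 1" using r(1) by (simp add: prime_gt_1_int)
      have r5: "r \<ge> 5" using coprime_6_ge_5[OF n(2) r(2) r1] .
      have k0: "k > 0" using n(1) k r1 by (simp add: zero_less_mult_iff)
      have rk: "\<not> r dvd k" using False r(1) k by auto
      show ?thesis
      proof (cases "k = 1")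
        case True
        thus ?thesis using balanced_prime_pair[OF r(1) r5] co sum bal k by simp
      next
        case k1: False
        hence "\<not> is_unit k" using k0 by auto
        then obtain s where s: "prime s" "s dvd k" using prime_divisor_exists k0 by (metis less_irrefl)
        then obtain l where l: "k = s * l" by blast
        have s1: "s > 1" using s(1) by (simp add: prime_gt_1_int)
        have sn: "s dvd n" using s k by simp
        have s5: "s \<ge> 5" using coprime_6_ge_5[OF n(2) sn s1] .
        have rs: "r \<noteq> s" using rk s by blast
        have l0: "l > 0" using k0 l s1 by (simp add: zero_less_mult_iff)
        \<comment> \<open>A further prime factor would be \<open>r\<close> or \<open>s\<close>
          again, and its square would divide \<open>n\<close>.\<close>
        have "l = 1"
        proof (rule ccontr)
          assume "l \<noteq> 1"
          hence "\<not> is_unit l" using l0 by auto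
          then obtain t where t: "prime t" "t dvd l" using prime_divisor_exists l0 by (metis less_irrefl)
          hence "t dvd n" using l k by simp
          hence "t = r \<or> t = s" using pq[OF t(1)] pq[OF r] pq[OF s(1) sn] rs by metis
          thus False
          proof
            assume "t = r"
            thus False using rk l t(2) by simp
          next
            assume "t = s"
            hence "s * s dvd n" using k l t(2) by (simp add: mult_dvd_mono)
            thus False using False s(1) by blast
          qed
        qed
        hence nrs: "n = r * s" "n = s * r" using k l by simp_all
        have "r < s \<or> s < r" using rs by linarith
        thus ?thesis
          using balanced_two_primes_pair[OF r(1) r5 s(1)] balanced_two_primes_pair[OF s(1) s5 r(1)]
            co sum bal nrs by metis
      qed
    qed
  qed
qed

text \<open>Suppose that no pair cancels. A prime of \<open>n\<close> dividing \<open>d\<close>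
  cannot divide two further terms, since it would divide all four, nor exactly one, by
  \<open>balanced_two_nondivisible\<close>. So it divides \<open>d\<close> alone, and its square
  does not divide \<open>n\<close>. If the other prime divided \<open>d\<close> as well,
  \<open>n\<close> would divide \<open>d\<close>; hence \<open>d\<close> is coprime to
  \<open>n / r\<close> and \<open>not_balanced_three_nondivisible\<close> applies.\<close>

lemma balanced_pair_if_common_prime:
  fixes p q n r a b c d :: int
  assumes n: "n > 0" "coprime n 6" and pq: "\<And>r. prime r \<Longrightarrow> r dvd n \<Longrightarrow> r = p \<or> r = q"
    and sum: "n dvd a + b + c + d" and bal: "balanced n a b c d"
    and gcd1: "\<And>r. prime r \<Longrightarrow> r dvd n \<Longrightarrow> \<not> (r dvd a \<and> r dvd b \<and> r dvd c \<and> r dvd d)"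
    and nd: "\<not> n dvd d" and r: "prime r" "r dvd n" "r dvd d"
  shows "n dvd a + b \<or> n dvd a + c \<or> n dvd a + d"
proof (rule ccontr)
  assume no: "\<not> ?thesis"
  have lone: "\<not> t dvd a \<and> \<not> t dvd b \<and> \<not> t dvd c" if t: "prime t" "t dvd n" "t dvd d" for t
  proof -
    have ts: "t dvd a + b + c + d" using sum t(2) dvd_trans by blast
    have comp: "t dvd x" if "t dvd y" "t dvd z" "x + y + z + d = a + b + c + d" for x y z
    proof -
      have "x = (a + b + c + d) - (y + z + d)" using that(3) by simp
      thus ?thesis using ts that(1,2) t(3) by (metis dvd_add dvd_diff)
    qed
    have 1: "\<not> (t dvd b \<and> t dvd c)" using comp[of b c a] gcd1[OF t(1,2)] t(3) by auto
    have 2: "\<not> (t dvd a \<and> t dvd c)" using comp[of a c b] gcd1[OF t(1,2)] t(3) by auto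
    have 3: "\<not> (t dvd a \<and> t dvd b)" using comp[of a b c] gcd1[OF t(1,2)] t(3) by auto
    have "\<not> t dvd c"
    proof
      assume "t dvd c"
      hence "n dvd a + b" using balanced_two_nondivisible[OF n t(1,2) _ _ _ t(3) sum bal] 1 2 by blast
      thus False using no by blast
    qed
    moreover have "\<not> t dvd b"
    proof
      assume "t dvd b"
      moreover have "n dvd a + c + b + d" using sum by (simp add: algebra_simps)
      moreover have "balanced n a c b d" using bal by (simp add: balanced_def algebra_simps)
      ultimately have "n dvd a + c" using balanced_two_nondivisible[OF n t(1,2) _ _ _ t(3)] 1 3 by blast
      thus False using no by blast
    qed
    moreover have "\<not> t dvd a"
    proof
      assume "t dvd a"
      moreover have "n dvd b + c + a + d" using sum by (simp add: algebra_simps)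
      moreover have "balanced n b c a d" using bal by (simp add: balanced_def algebra_simps)
      ultimately have "n dvd b + c" using balanced_two_nondivisible[OF n t(1,2) _ _ _ t(3)] 2 3 by blast
      moreover have "a + d = (a + b + c + d) - (b + c)" by simp
      ultimately have "n dvd a + d" using sum by (metis dvd_diff)
      thus False using no by blast
    qed
    ultimately show ?thesis by blast
  qed
  have sqf: "\<not> t dvd k" if t: "prime t" "n = t * k" "t dvd d" for t k
  proof
    assume "t dvd k"
    moreover have "t dvd n" using t(2) by simp
    ultimately show False
      using not_balanced_three_nondivisible_sq[OF n t(1,2)] lone[OF t(1) _ t(3)] t(3) nd bal by blast
  qed
  obtain k where k: "n = r * k" using r(2) by blast
  have r1: "r > 1" using r(1) by (simp add: prime_gt_1_int)
  have k0: "k > 0" using n(1) k r1 by (simp add: zero_less_mult_iff)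
  have "k \<noteq> 1" using nd k r(3) by auto
  hence k1: "k > 1" using k0 by simp
  have rk: "\<not> r dvd k" using sqf[OF r(1) k r(3)] .
  have "coprime d k"
    unfolding coprime_int_prime_iff[OF less_imp_neq[OF k0, symmetric]]
  proof (intro allI impI notI)
    fix t assume t: "prime t" "t dvd k" "t dvd d"
    then obtain l where l: "k = t * l" by blast
    have t1: "t > 1" using t(1) by (simp add: prime_gt_1_int)
    have tn: "t dvd n" using k t(2) by simp
    have rt: "r \<noteq> t" using rk t(2) by blast
    have l0: "l > 0" using k0 l t1 by (simp add: zero_less_mult_iff)
    have "n = t * (r * l)" using k l by simp
    hence tl: "\<not> t dvd r * l" using sqf t by blast
    have "l = 1"
    proof (rule ccontr)
      assume "l \<noteq> 1"
      hence "\<not> is_unit l" using l0 by auto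
      then obtain u where u: "prime u" "u dvd l" using prime_divisor_exists l0 by (metis less_irrefl)
      hence "u dvd n" using l k by simp
      hence "u = r \<or> u = t" using pq[OF u(1)] pq[OF r(1,2)] pq[OF t(1) tn] rt by metis
      thus False using rk l tl u(2) by auto
    qed
    hence "n = r * t" using k l by simp
    moreover have "coprime r t" using r(1) t(1) rt primes_coprime by blast
    ultimately have "n dvd d" using divides_mult[OF r(3) t(3)] by simp
    thus False using nd by blast
  qed
  moreover have "k dvd a + b + c + d" using sum k dvd_mult_right by blast
  ultimately show False
    using not_balanced_three_nondivisible[OF k1 _ r(1) rk] lone[OF r] r(3) bal n(2) unfolding k by blast
qed

lemma balanced_pair_primitive:
  fixes p q n a b c d :: int
  assumes n: "n > 0" "coprime n 6" and pq: "\<And>r. prime r \<Longrightarrow> r dvd n \<Longrightarrow> r = p \<or> r = q"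
    and sum: "n dvd a + b + c + d" and bal: "balanced n a b c d"
    and gcd1: "\<And>r. prime r \<Longrightarrow> r dvd n \<Longrightarrow> \<not> (r dvd a \<and> r dvd b \<and> r dvd c \<and> r dvd d)"
    and nd: "\<not> n dvd a" "\<not> n dvd b" "\<not> n dvd c" "\<not> n dvd d"
  shows "n dvd a + b \<or> n dvd a + c \<or> n dvd a + d"
proof (cases "coprime a n \<and> coprime b n \<and> coprime c n \<and> coprime d n")
  case True
  thus ?thesis using balanced_units_pair[OF n pq _ _ _ _ sum bal] by blast
next
  case False
  have n0: "n \<noteq> 0" using n by simp
  obtain r where r: "prime r" "r dvd n" "r dvd a \<or> r dvd b \<or> r dvd c \<or> r dvd d"
    using False unfolding coprime_int_prime_iff[OF n0] by blast
  have sums: "n dvd b + c + d + a" "n dvd a + c + d + b" "n dvd a + b + d + c"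
    using sum by (simp_all add: algebra_simps)
  have bals: "balanced n b c d a" "balanced n a c d b" "balanced n a b d c"
    using bal by (simp_all add: balanced_def algebra_simps)
  note aux = balanced_pair_if_common_prime[where p = p and q = q, OF n]
  have comp: "n dvd x + y" if "n dvd z + w" "x + y + z + w = a + b + c + d" for x y z w
  proof -
    have "x + y = (a + b + c + d) - (z + w)" using that(2) by simp
    thus ?thesis using sum that(1) by (metis dvd_diff)
  qed
  from r(3) consider "r dvd a" | "r dvd b" | "r dvd c" | "r dvd d" by blast
  thus ?thesis
  proof cases
    case 1
    have "n dvd b + c \<or> n dvd b + d \<or> n dvd b + a"
      by (rule aux[OF _ sums(1) bals(1) _ nd(1) r(1,2) 1]) (use pq gcd1 in blast)+
    thus ?thesis using comp[of b c a d] comp[of b d a c] comp[of a d b c] comp[of a c b d]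
      by (auto simp: algebra_simps)
  next
    case 2
    have "n dvd a + c \<or> n dvd a + d \<or> n dvd a + b"
      by (rule aux[OF _ sums(2) bals(2) _ nd(2) r(1,2) 2]) (use pq gcd1 in blast)+
    thus ?thesis by blast
  next
    case 3
    have "n dvd a + b \<or> n dvd a + d \<or> n dvd a + c"
      by (rule aux[OF _ sums(3) bals(3) _ nd(3) r(1,2) 3]) (use pq gcd1 in blast)+
    thus ?thesis by blast
  next
    case 4
    show ?thesis by (rule aux[OF _ sum bal _ nd(4) r(1,2) 4]) (use pq gcd1 in blast)+
  qed
qed

text \<open>The common divisor \<open>g\<close> of \<open>n\<close> and the four terms is divided
  out. Balance survives because a unit modulo \<open>n / g\<close> lifts to one modulo
  \<open>n\<close>, and residues simply scale by \<open>g\<close>.\<close>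

lemma balanced_pair:
  fixes p q n a b c d :: int
  assumes n: "n > 0" "coprime n 6" and pq: "\<And>r. prime r \<Longrightarrow> r dvd n \<Longrightarrow> r = p \<or> r = q"
    and sum: "n dvd a + b + c + d" and bal: "balanced n a b c d"
    and nd: "\<not> n dvd a" "\<not> n dvd b" "\<not> n dvd c" "\<not> n dvd d"
  shows "n dvd a + b \<or> n dvd a + c \<or> n dvd a + d"
proof -
  define g where "g = gcd n (gcd (gcd a b) (gcd c d))"
  have g0: "g > 0" using n(1) by (simp add: g_def)
  have gd: "g dvd n" "g dvd a" "g dvd b" "g dvd c" "g dvd d"
    unfolding g_def by (meson dvd_trans gcd_dvd1 gcd_dvd2)+
  obtain n' a' b' c' d' where e: "n = g * n'" "a = g * a'" "b = g * b'" "c = g * c'" "d = g * d'"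
    using gd by (meson dvdE)
  have n'0: "n' > 0" using n(1) e(1) g0 by (simp add: zero_less_mult_iff)
  have canc: "n dvd g * x \<longleftrightarrow> n' dvd x" for x using e(1) g0 by simp
  have "n' dvd a' + b' \<or> n' dvd a' + c' \<or> n' dvd a' + d'"
  proof (rule balanced_pair_primitive)
    show "n' > 0" by (rule n'0)
    show "coprime n' 6" using n(2) e(1) by simp
    show "r = p \<or> r = q" if "prime r" "r dvd n'" for r using pq[OF that(1)] that(2) e(1) by simp
    show "n' dvd a' + b' + c' + d'" using sum canc[of "a' + b' + c' + d'"] e by (simp add: distrib_left)
    show "\<not> n' dvd a'" "\<not> n' dvd b'" "\<not> n' dvd c'" "\<not> n' dvd d'" using nd canc e by auto
    show "\<not> (r dvd a' \<and> r dvd b' \<and> r dvd c' \<and> r dvd d')" if r: "prime r" "r dvd n'" for r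
    proof
      assume "r dvd a' \<and> r dvd b' \<and> r dvd c' \<and> r dvd d'"
      hence "g * r dvd n" "g * r dvd a" "g * r dvd b" "g * r dvd c" "g * r dvd d"
        using r(2) e by (simp_all add: mult_dvd_mono)
      hence "g * r dvd g" unfolding g_def[symmetric] using g_def by (metis gcd_greatest)
      hence "is_unit r" using g0 by (metis dvd_mult_cancel_left less_irrefl mult.right_neutral)
      thus False using r(1) not_prime_unit by blast
    qed
    show "balanced n' a' b' c' d'"
      unfolding balanced_def
    proof (intro allI impI)
      fix m' assume "coprime m' n'"
      moreover have "n' dvd n" "n \<noteq> 0" using e(1) n(1) by auto
      ultimately obtain m where m: "coprime m n" "[m = m'] (mod n')" by (rule coprime_lift)
      have eq: "m * (g * x) mod n = g * (m' * x mod n')" for x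
      proof -
        have "m * (g * x) mod n = g * (m * x) mod (g * n')" by (simp add: e(1) mult.left_commute)
        also have "\<dots> = g * (m * x mod n')" by (rule mult_mod_right[symmetric])
        also have "m * x mod n' = m' * x mod n'" using cong_scalar_right[OF m(2), of x] by (simp add: cong_def)
        finally show ?thesis .
      qed
      have "g * (m' * a' mod n') + g * (m' * b' mod n') + g * (m' * c' mod n') + g * (m' * d' mod n') = 2 * n"
        using balancedD[OF bal m(1)] unfolding e(2-5) eq .
      hence "g * (m' * a' mod n' + m' * b' mod n' + m' * c' mod n' + m' * d' mod n') = g * (2 * n')"
        unfolding e(1) distrib_left by (simp only: mult.left_commute)
      thus "m' * a' mod n' + m' * b' mod n' + m' * c' mod n' + m' * d' mod n' = 2 * n'" using g0 by simp
    qed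
  qed
  thus ?thesis using canc[of "a' + b'"] canc[of "a' + c'"] canc[of "a' + d'"] e by (simp add: distrib_left)
qed

section \<open>The index of a sequence of length four\<close>

lemma (in group) ord_generator:
  assumes "g \<in> generators G"
  shows "g \<in> carrier G" "ord g = order G"
  using assms generate_pow_card by (auto simp: generators_def order_def)

lemma (in group) pow_generator_eq_iff:
  assumes "g \<in> generators G"
  shows "g [^] (i::nat) = g [^] (j::nat) \<longleftrightarrow> int (order G) dvd int i - int j"
  using int_pow_eq[of g "int i" "int j"] ord_generator[OF assms] by (simp add: int_pow_int dvd_diff_commute)

lemma (in group) coefficient_generator:
  assumes "finite (carrier G)" "g \<in> generators G" "x \<in> carrier G"
  shows "1 \<le> coefficient G g x" "coefficient G g x \<le> order G" "g [^] coefficient G g x = x"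
  using theI'[OF ex1_coefficient[OF assms]] unfolding coefficient_def by auto

lemma (in group) coefficient_eqI:
  assumes "finite (carrier G)" "g \<in> generators G" "1 \<le> m" "m \<le> order G"
  shows "coefficient G g (g [^] m) = m"
proof -
  have "g [^] m \<in> carrier G" using ord_generator[OF assms(2)] by simp
  from ex1_coefficient[OF assms(1,2) this] show ?thesis
    unfolding coefficient_def using assms(3,4) by (intro the1_equality) auto
qed

lemma (in comm_group) seq_sum_pow:
  assumes "g \<in> carrier G"
  shows "seq_sum G (image_mset (\<lambda>a. g [^] a) M) = g [^] (\<Sum>a\<in>#M. a :: nat)"
proof (induction M)
  case empty
  show ?case by (simp add: seq_sum_def)
next
  case (add a M)
  have "sequence_over G (image_mset (\<lambda>a. g [^] a) M)" using assms by (auto simp: sequence_over_def)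
  thus ?case using add assms by (simp add: seq_sum_add_mset nat_pow_mult)
qed

text \<open>The generator is \<open>h = g [^] u\<close> with \<open>u\<close> inverse to
  \<open>m\<close>, so that \<open>g\<close> is the \<open>m\<close>-th multiple of
  \<open>h\<close>. Coefficients range from 1 to the order, not from 0, so they agree with residues
  only for exponents not divisible by the order.\<close>

lemma (in group) unit_power_generator:
  fixes m :: int
  assumes "finite (carrier G)" "g \<in> generators G" "coprime m (int (order G))"
  obtains h where "h \<in> generators G"
    "\<And>a. \<not> int (order G) dvd int a \<Longrightarrow> int (coefficient G h (g [^] a)) = m * int a mod int (order G)"
proof -
  define n where "n = int (order G)"
  have g: "g \<in> carrier G" "ord g = order G" using ord_generator[OF assms(2)] by auto
  have "order G > 0" using assms(1) by (simp add: order_gt_0_iff_finite)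
  hence n0: "n > 0" by (simp add: n_def)
  obtain u' where u': "[m * u' = 1] (mod n)" using cong_solve_coprime_int assms(3) n_def by blast
  define u where "u = nat (u' mod n)"
  have u: "int u = u' mod n" using n0 by (simp add: u_def)
  have "[m * int u = m * u'] (mod n)" unfolding u by (intro cong_scalar_left) (simp add: cong_def)
  hence mu: "[m * int u = 1] (mod n)" using u' cong_trans by blast
  define h where "h = g [^] u"
  have h: "h \<in> carrier G" using g by (simp add: h_def)
  have pw: "h [^] nat (m * int a mod n) = g [^] a" for a
  proof -
    have i: "int (nat (m * int a mod n)) = m * int a mod n" using n0 by simp
    have "[int u * (m * int a mod n) = int u * (m * int a)] (mod n)"
      by (intro cong_scalar_left) (simp add: cong_def)
    also have "int u * (m * int a) = m * int u * int a" by simp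
    also have "[\<dots> = 1 * int a] (mod n)" using mu by (rule cong_scalar_right)
    finally have "[int u * (m * int a mod n) = int a] (mod n)" by simp
    hence "n dvd int (u * nat (m * int a mod n)) - int a"
      unfolding of_nat_mult i by (simp add: cong_iff_dvd_diff)
    thus ?thesis unfolding h_def using g
      by (simp only: nat_pow_pow pow_generator_eq_iff[OF assms(2)] n_def)
  qed
  have "g = h [^] nat (m * int 1 mod n)" using pw[of 1] g by simp
  hence "g \<in> generate G {h}"
    unfolding generate_pow_on_finite_carrier[OF assms(1) h] by blast
  hence "generate G {g} \<subseteq> generate G {h}"
    using h by (intro generate_subgroup_incl) (auto intro: generate_is_subgroup)
  moreover have "generate G {h} \<subseteq> carrier G" using h by (intro generate_incl) auto
  ultimately have hg: "h \<in> generators G" using assms(2) h by (auto simp: generators_def)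
  show ?thesis
  proof (rule that[OF hg])
    fix a assume a: "\<not> int (order G) dvd int a"
    define j where "j = nat (m * int a mod n)"
    have j: "int j = m * int a mod n" using n0 by (simp add: j_def)
    have "\<not> n dvd m * int a"
      using a assms(3) by (simp add: n_def coprime_dvd_mult_right_iff coprime_commute)
    hence "int j \<noteq> 0" unfolding j by (simp add: dvd_eq_mod_eq_0)
    moreover have "int j < n" unfolding j using n0 by simp
    ultimately have "1 \<le> j" "j \<le> order G" unfolding n_def by linarith+
    hence "coefficient G h (h [^] j) = j" by (rule coefficient_eqI[OF assms(1) hg])
    thus "int (coefficient G h (g [^] a)) = m * int a mod int (order G)"
      using pw[of a] j unfolding j_def n_def by simp
  qed
qed

lemma (in comm_group) zero_sum_pow_iff:
  assumes "g \<in> generators G"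
  shows "zero_sum G (image_mset (\<lambda>a. g [^] a) M) \<longleftrightarrow> int (order G) dvd int (\<Sum>a\<in>#M. a :: nat)"
proof -
  have g: "g \<in> carrier G" using ord_generator[OF assms] by simp
  have "sequence_over G (image_mset (\<lambda>a. g [^] a) M)" using g by (auto simp: sequence_over_def)
  thus ?thesis
    using pow_generator_eq_iff[OF assms, of "\<Sum>a\<in>#M. a" 0] g by (simp add: zero_sum_def seq_sum_pow)
qed

lemma size_4_mset:
  fixes S :: "'a multiset"
  assumes "size S = 4"
  obtains a b c d where "S = {#a, b, c, d#}"
proof -
  have suc: "\<exists>x N. M = add_mset x N \<and> size N = k" if "size M = Suc k" for M :: "'a multiset" and k
    using that by (metis size_eq_Suc_imp_eq_union size_add_mset nat.inject)
  have "size S = Suc (Suc (Suc (Suc 0)))" using assms by simp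
  from suc[OF this] obtain a S1 where 1: "S = add_mset a S1" "size S1 = Suc (Suc (Suc 0))" by blast
  from suc[OF 1(2)] obtain b S2 where 2: "S1 = add_mset b S2" "size S2 = Suc (Suc 0)" by blast
  from suc[OF 2(2)] obtain c S3 where 3: "S2 = add_mset c S3" "size S3 = Suc 0" by blast
  from suc[OF 3(2)] obtain d S4 where 4: "S3 = add_mset d S4" "size S4 = 0" by blast
  show ?thesis using that 1 2 3 4 by simp
qed

theorem theorem1p3:
  fixes G :: "('a, 'b) monoid_scheme"
    and p q \<alpha> \<beta> :: nat
    and S :: "'a multiset"
  assumes "group G" and "finite (carrier G)" and "cyclic_group G"
    and "Factorial_Ring.prime p" and "Factorial_Ring.prime q" and "p \<noteq> q"
    and "\<alpha> > 0" and "\<beta> > 0"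
    and "order G = p ^ \<alpha> * q ^ \<beta>"
    and "gcd (order G) 6 = 1"
    and "minimal_zero_sum G S" and "size S = 4"
  shows "seq_index G S = 1"
proof -
  interpret group G by (rule assms(1))
  interpret comm_group G by (rule cyclic_imp_abelian_group[OF assms(3)])
  note fin = assms(2)
  define n where "n = int (order G)"
  have "order G > 0" using fin by (simp add: order_gt_0_iff_finite)
  hence n0: "n > 0" by (simp add: n_def)
  have n6: "coprime n 6"
  proof -
    have "coprime (order G) 6" using assms(10) by (simp add: coprime_iff_gcd_eq_1)
    hence "coprime (int (order G)) (int 6)" by (simp only: coprime_int_iff)
    thus ?thesis by (simp add: n_def)
  qed
  have npq: "r = int p \<or> r = int q" if r: "prime r" "r dvd n" for r :: int
  proof -
    have "r dvd int p ^ \<alpha> * int q ^ \<beta>" using r(2) by (simp add: n_def assms(9))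
    hence "r dvd int p \<or> r dvd int q" using r(1) by (meson prime_dvd_mult_iff prime_dvd_power)
    moreover have "prime (int p)" "prime (int q)" using assms(4,5) by simp_all
    ultimately show ?thesis using r(1) primes_dvd_imp_eq by blast
  qed
  obtain g where g: "g \<in> generators G" using generators_finite_nonempty[OF fin assms(3)] by blast
  obtain s1 s2 s3 s4 where S: "S = {#s1, s2, s3, s4#}" using size_4_mset[OF assms(12)] .
  have Sc: "s1 \<in> carrier G" "s2 \<in> carrier G" "s3 \<in> carrier G" "s4 \<in> carrier G"
    using assms(11) by (auto simp: S minimal_zero_sum_def zero_sum_def sequence_over_def)
  have norm: "seq_norm G h S = real (coefficient G h s1 + coefficient G h s2 + coefficient G h s3
      + coefficient G h s4) / real (order G)" if "h \<in> generators G" for h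
    using ord_generator[OF that] by (simp add: seq_norm_def S)
  have pows: "S = image_mset (\<lambda>a. h [^]\<^bsub>G\<^esub> a)
      {#coefficient G h s1, coefficient G h s2, coefficient G h s3, coefficient G h s4#}"
    if "h \<in> generators G" for h
    using coefficient_generator(3)[OF fin that] Sc by (simp add: S)
  have zs: "zero_sum G S" using assms(11) by (simp add: minimal_zero_sum_def)
  \<comment> \<open>The coefficients are at least 1 and their sum is a multiple of \<open>n\<close>,
    hence at least \<open>n\<close>.\<close>
  have ge: "seq_norm G h S \<ge> 1" if h: "h \<in> generators G" for h
  proof -
    let ?c = "coefficient G h s1 + coefficient G h s2 + coefficient G h s3 + coefficient G h s4"
    have "zero_sum G (image_mset (\<lambda>a. h [^]\<^bsub>G\<^esub> a)
        {#coefficient G h s1, coefficient G h s2, coefficient G h s3, coefficient G h s4#})"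
      using zs by (subst (asm) pows[OF h])
    hence "n dvd int ?c" unfolding zero_sum_pow_iff[OF h] by (simp add: n_def add_ac)
    moreover have "int ?c > 0" using coefficient_generator(1)[OF fin h Sc(1)] by simp
    ultimately have "n \<le> int ?c" by (rule zdvd_imp_le)
    hence "real (order G) \<le> real ?c" unfolding n_def by linarith
    thus ?thesis unfolding norm[OF h] using \<open>order G > 0\<close> by simp
  qed
  define a where "a = coefficient G g s1"
  define b where "b = coefficient G g s2"
  define c where "c = coefficient G g s3"
  define d where "d = coefficient G g s4"
  have Sg: "S = image_mset (\<lambda>a. g [^]\<^bsub>G\<^esub> a) {#a, b, c, d#}"
    using pows[OF g] unfolding a_def b_def c_def d_def .
  have min: "\<not> n dvd int (\<Sum>x\<in>#T. x)" if T: "T \<subset># {#a, b, c, d#}" "T \<noteq> {#}" for T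
  proof -
    have "image_mset (\<lambda>a. g [^]\<^bsub>G\<^esub> a) T \<subset># S" unfolding Sg using T(1) by (rule image_mset_subset_mono)
    moreover have "image_mset (\<lambda>a. g [^]\<^bsub>G\<^esub> a) T \<noteq> {#}" using T(2) by simp
    ultimately have "\<not> zero_sum G (image_mset (\<lambda>a. g [^]\<^bsub>G\<^esub> a) T)"
      using assms(11) unfolding minimal_zero_sum_def by blast
    thus ?thesis unfolding zero_sum_pow_iff[OF g] n_def .
  qed
  have sub: "{#x#} \<subset># {#a, b, c, d#}" if "x \<in># {#a, b, c, d#}" for x
    using that by (simp add: subset_mset.less_le)
  have nd: "\<not> n dvd int a" "\<not> n dvd int b" "\<not> n dvd int c" "\<not> n dvd int d"
    using min[OF sub] by (force)+
  have "{#a, b#} \<subset># {#a, b, c, d#}" "{#a, c#} \<subset># {#a, b, c, d#}" "{#a, d#} \<subset># {#a, b, c, d#}"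
    by (simp_all add: subset_mset.less_le add_mset_commute)
  hence np: "\<not> n dvd int a + int b" "\<not> n dvd int a + int c" "\<not> n dvd int a + int d"
    using min[of "{#a, b#}"] min[of "{#a, c#}"] min[of "{#a, d#}"] by simp_all
  have sum: "n dvd int a + int b + int c + int d"
    using zs unfolding Sg zero_sum_pow_iff[OF g] by (simp add: n_def add_ac)
  have "\<not> balanced n (int a) (int b) (int c) (int d)"
    using balanced_pair[OF n0 n6 npq sum] nd np by blast
  then obtain m where m: "coprime m n"
    and ne: "m * int a mod n + m * int b mod n + m * int c mod n + m * int d mod n \<noteq> 2 * n"
    unfolding balanced_def by blast
  define R where "R = (\<lambda>m. m * int a mod n + m * int b mod n + m * int c mod n + m * int d mod n)"
  have pos: "0 < m * x mod n" "m * x mod n < n" "- m * x mod n = n - m * x mod n"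
    if "\<not> n dvd x" for x
  proof -
    have "\<not> n dvd m * x" using that m by (metis coprime_commute coprime_dvd_mult_right_iff)
    hence nz: "m * x mod n \<noteq> 0" by (simp add: dvd_eq_mod_eq_0)
    thus "0 < m * x mod n" using pos_mod_sign[OF n0, of "m * x"] by linarith
    show "m * x mod n < n" by (rule pos_mod_bound[OF n0])
    show "- m * x mod n = n - m * x mod n" using nz by (simp add: zmod_zminus1_eq_if)
  qed
  \<comment> \<open>\<open>R m\<close> is a multiple of \<open>n\<close> strictly between 0 and
    \<open>4 * n\<close> and different from \<open>2 * n\<close>. As no residue is 0,
    \<open>- m\<close> replaces each by its complement to \<open>n\<close>, which turns
    \<open>3 * n\<close> into \<open>n\<close>.\<close>
  have "R m = n \<or> R (- m) = n"
  proof -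
    have "[R m = m * int a + m * int b + m * int c + m * int d] (mod n)"
      unfolding R_def by (intro cong_add) (simp_all add: cong_def)
    moreover have "m * int a + m * int b + m * int c + m * int d = m * (int a + int b + int c + int d)"
      by (simp add: algebra_simps)
    hence "n dvd m * int a + m * int b + m * int c + m * int d" using sum by simp
    ultimately have "n dvd R m" using cong_dvd_iff by blast
    then obtain t where t: "R m = n * t" by blast
    have "0 < n * t" "n * t < n * 4"
      unfolding t[symmetric] R_def using pos[OF nd(1)] pos[OF nd(2)] pos[OF nd(3)] pos[OF nd(4)] by linarith+
    hence "0 < t" "t < 4" using n0 by (simp_all add: zero_less_mult_iff)
    moreover have "t \<noteq> 2" using ne t by (auto simp: R_def)
    ultimately have "t = 1 \<or> t = 3" by linarith
    moreover have "R (- m) = 4 * n - R m"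
      unfolding R_def using pos(3)[OF nd(1)] pos(3)[OF nd(2)] pos(3)[OF nd(3)] pos(3)[OF nd(4)] by linarith
    ultimately show ?thesis using t by auto
  qed
  moreover have "coprime (- m) n" using m by simp
  ultimately obtain m' where m': "coprime m' n" "R m' = n" using m by blast
  obtain h where h: "h \<in> generators G"
    "\<And>x. \<not> n dvd int x \<Longrightarrow> int (coefficient G h (g [^]\<^bsub>G\<^esub> x)) = m' * int x mod n"
    using unit_power_generator[OF fin g] m'(1) unfolding n_def by blast
  have gs: "s1 = g [^]\<^bsub>G\<^esub> a" "s2 = g [^]\<^bsub>G\<^esub> b" "s3 = g [^]\<^bsub>G\<^esub> c" "s4 = g [^]\<^bsub>G\<^esub> d"
    using coefficient_generator(3)[OF fin g] Sc by (simp_all add: a_def b_def c_def d_def)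
  have "int (coefficient G h s1 + coefficient G h s2 + coefficient G h s3 + coefficient G h s4) = n"
    using m'(2) h(2) nd unfolding R_def gs by simp
  hence "coefficient G h s1 + coefficient G h s2 + coefficient G h s3 + coefficient G h s4 = order G"
    unfolding n_def by linarith
  hence "seq_norm G h S = 1" unfolding norm[OF h(1)] using \<open>order G > 0\<close> by simp
  thus ?thesis
    unfolding seq_index_def using h(1) ge generators_finite_nonempty[OF fin assms(3)]
    by (intro Min_eqI) (auto simp: image_iff intro: bexI[of _ h])
qed

end
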